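(* Let $f=h+\overline{g}$ be a harmonic function in $\mathbb{D}$, where $h,g$ are analytic in $\mathbb{D}$ with $g(0)=0$ and $$h(z)=\sum_{n=0}^\infty a_nz^n,\qquad g(z)=\sum_{n=0}^\infty b_nz^n$$ (so $b_0=0$). Then the following statements hold. (i) If $f\in h^p$ for some $p\in(1,2]$, then $$\sum_{n=0}^\infty (n+1)^{p-2}\left(|a_n|^p+|b_n|^p\right)<\infty.$$ Furthermore, suppose $a_n\downarrow0$ and $b_n\downarrow 0$. Then, for $1<p<\infty$, $f\in h^p$ if and only if $$\sum_{n=0}^\infty (n+1)^{p-2}\left(|a_n|^p+|b_n|^p\right)<\infty.$$ (ii) If $f\in h^1$, then $$\sum_{n=0}^\infty (n+1)^{p-2}\left(|a_n|^p+|b_n|^p\right)<\infty$$ for every $p$ with $0<p<1$. (iii) Suppose $\operatorname{Im} h(z)\ne0$ for all $z\in\mathbb{D}$, and $a_n\downarrow0$, $b_n\downarrow0$. If $f\in h^1$, then $$\sum_{n=0}^\infty\frac{|a_n+b_n|}{n+1}<\infty.$$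
   Context: $\mathbb{D}=\{z\in\mathbb{C}:|z|<1\}$. A complex-valued function is harmonic in $\mathbb{D}$ if its real and imaginary parts are real-valued harmonic functions; every such function can be written $f=h+\overline g$ with $h,g$ analytic in $\mathbb{D}$, uniquely under the normalization $g(0)=0$. For $0<p<\infty$, $M_p(r,f)=\left(\frac1{2\pi}\int_0^{2\pi}|f(re^{i\theta})|^p\,d\theta\right)^{1/p}$, and $h^p$ is the class of functions $f$ harmonic in $\mathbb{D}$ with $\lim_{r\to1^-}M_p(r,f)<\infty$. The notation $a_n\downarrow0$ (respectively $b_n\downarrow0$) means that the numbers $a_n$ (respectively $b_n$), $n\ge1$, are real and nonnegative, form a non-increasing sequence, and tend to $0$ as $n\to\infty$; no condition is imposed on the index $n=0$ term (apart from $b_0=0$). *)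

theory Defs
  imports "HOL-Complex_Analysis.Complex_Analysis"
begin

(* Twice continuously differentiable with vanishing Laplacian, for z = x + i y:
   ux, uy are the first-order and uxx, uxy, uyx, uyy the second-order partial derivatives of u. *)
definition real_harmonic_on :: "(complex \<Rightarrow> real) \<Rightarrow> complex set \<Rightarrow> bool"
  where "real_harmonic_on u S \<longleftrightarrow> open S \<and>
    (\<exists>ux uy uxx uxy uyx uyy :: complex \<Rightarrow> real.
       (\<forall>z\<in>S. (u has_derivative (\<lambda>v. ux z * Re v + uy z * Im v)) (at z)) \<and>
       (\<forall>z\<in>S. (ux has_derivative (\<lambda>v. uxx z * Re v + uxy z * Im v)) (at z)) \<and>
       (\<forall>z\<in>S. (uy has_derivative (\<lambda>v. uyx z * Re v + uyy z * Im v)) (at z)) \<and>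
       continuous_on S uxx \<and> continuous_on S uxy \<and>
       continuous_on S uyx \<and> continuous_on S uyy \<and>
       (\<forall>z\<in>S. uxx z + uyy z = 0))"

definition complex_harmonic_on :: "(complex \<Rightarrow> complex) \<Rightarrow> complex set \<Rightarrow> bool"
  where "complex_harmonic_on f S \<longleftrightarrow>
    real_harmonic_on (\<lambda>z. Re (f z)) S \<and> real_harmonic_on (\<lambda>z. Im (f z)) S"

definition integral_mean :: "real \<Rightarrow> real \<Rightarrow> (complex \<Rightarrow> complex) \<Rightarrow> real"
  where "integral_mean p r f =
    (1 / (2 * pi) * integral {0..2 * pi} (\<lambda>\<theta>. norm (f (of_real r * cis \<theta>)) powr p)) powr (1 / p)"

(* Only meaningful for p > 0. *)
definition harmonic_hardy :: "real \<Rightarrow> (complex \<Rightarrow> complex) set"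
  where "harmonic_hardy p = {f. complex_harmonic_on f (ball 0 1) \<and>
    (\<exists>L::real. ((\<lambda>r. integral_mean p r f) \<longlongrightarrow> L) (at_left 1))}"

(* The term of index 0 is deliberately unconstrained. *)
definition decreasing_to_zero :: "(nat \<Rightarrow> complex) \<Rightarrow> bool"
  where "decreasing_to_zero a \<longleftrightarrow>
    (\<forall>n\<ge>1. a n \<in> \<real> \<and> Re (a n) \<ge> 0) \<and>
    (\<forall>n\<ge>1. Re (a (Suc n)) \<le> Re (a n)) \<and>
    a \<longlonglongrightarrow> 0"

end

theory Submission
  imports Defs
begin

text \<open>The coefficients \<open>a n * r ^ n\<close> and \<open>cnj (b n) * r ^ n\<close> are the Fourier coefficients of
  \<open>f\<close> on the circle of radius \<open>r\<close>. For \<open>f\<close> in \<open>h^1\<close> they are bounded, which settles \<open>p < 1\<close>; for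
  \<open>1 < p < 2\<close> the claim is Paley's inequality, obtained by cutting \<open>f\<close> at height \<open>t\<close>, estimating the
  large part in \<open>L^1\<close> and the small part by Bessel's inequality, and integrating over \<open>t\<close>.

  For decreasing coefficients only \<open>Re f\<close> is needed in one direction: it is a cosine series with the
  decreasing coefficients \<open>a n + b n\<close>, and pairing it with the tent \<open>max (x - t) 0\<close>, \<open>x = 1 / n\<close>,
  bounds \<open>a n + b n\<close> by a multiple of the integral of \<open>|f| + |a 0|\<close> over \<open>[0, 1 / n]\<close>; Hardy's
  inequality finishes. Conversely, summation by parts bounds \<open>|h|\<close> at distance about \<open>s\<close> from \<open>1\<close> by
  the partial sum of length \<open>pi / s\<close>, so Hardy's inequality yields an integrable majorant of
  \<open>|h|^p\<close> that is uniform in \<open>r\<close>, and dominated convergence gives the limit of the means.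

  If \<open>Im h\<close> never vanishes it has constant sign and hence constant integral means, so
  \<open>Im (h + g) = 2 Im h - Im f\<close> has bounded means; pairing it with \<open>pi - t\<close> produces the sum of
  \<open>(a n + b n) * r ^ n / n\<close>.\<close>

subsection \<open>Hardy's inequality\<close>

text \<open>Membership in \<open>harmonic_hardy p\<close> asks that the limit of the means exists.
  Rather than through monotonicity of the means in \<open>r\<close>, this is obtained from an
  integrable majorant together with pointwise radial limits, which decreasing coefficients provide
  at every boundary point except possibly 1. The number \<open>a 0\<close> is arbitrary and complex,
  so it is split off wherever signs or monotonicity of the coefficients enter.

  Conjugation preserves real parts, so Re f = Re (h + g); this is the origin of the coefficients
  \<open>a n + b n\<close>. For \<open>n >= 1\<close> both summands are nonnegative, hence each is
  dominated by the sum.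

  The cutting at height \<open>t\<close> is Marcinkiewicz interpolation for the map that sends a
  function to the sequence of (n + 1) times its n-th coefficient, on the naturals with mass 1 / (n +
  1)^2 at n: weak type (1,1) is elementary and type (2,2) is Bessel's inequality. The weight (n +
  1)^(p - 2) is this mass times (n + 1)^p.\<close>

text \<open>If \<open>x > m\<close>, then \<open>x powr (1 - p) <= m powr (1 - p)\<close> because
  the exponent is negative, and the second summand alone suffices. A free weight \<open>m\<close>
  makes this a linear substitute for Hoelder's inequality.\<close>

lemma le_add_powr_mult_powr:
  fixes x m p :: real
  assumes "0 \<le> x" "0 < m" "1 < p"
  shows "x \<le> m + x powr p * m powr (1 - p)"
proof (cases "x \<le> m")
  case True
  then show ?thesis by (simp add: add_increasing2)
next
  case False
  have "x = x powr p * x powr (1 - p)"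
    using False assms by (simp add: powr_add[symmetric])
  also have "\<dots> \<le> x powr p * m powr (1 - p)"
    using False assms by (intro mult_left_mono powr_mono2') auto
  finally show ?thesis using assms by simp
qed

text \<open>Stands in for Hoelder's inequality: \<open>X\<close>, \<open>M\<close>, \<open>S\<close> are the sums or integrals of
  \<open>x\<close>, \<open>m\<close>, \<open>x powr p * m powr (1 - p)\<close>, and the hypothesis is the previous lemma for the weight
  \<open>K * m\<close>.\<close>

lemma powr_le_of_parametric_bound:
  fixes X M S p :: real
  assumes "0 \<le> X" "0 < M" "0 \<le> S" "1 < p"
    and bound: "\<And>K. 0 < K \<Longrightarrow> X \<le> K * M + K powr (1 - p) * S"
  shows "X powr p \<le> 2 powr p * M powr (p - 1) * S"
proof (cases "X = 0")
  case True
  then show ?thesis using assms by simp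
next
  case False
  with assms have X: "X > 0" by simp
  \<comment> \<open>With this choice \<open>K * M\<close> is \<open>X / 2\<close>, which is absorbed
    on the left; only the term with \<open>S\<close> remains.\<close>
  define K where "K = X / (2 * M)"
  have K: "K > 0" using X assms by (simp add: K_def)
  have "X \<le> X / 2 + K powr (1 - p) * S"
    using bound[OF K] assms by (simp add: K_def)
  then have "X \<le> 2 * K powr (1 - p) * S" by simp
  then have "X powr (p - 1) * X \<le> X powr (p - 1) * (2 * K powr (1 - p) * S)"
    by (intro mult_left_mono) auto
  also have "X powr (p - 1) * X = X powr p"
    using X by (simp add: powr_diff)
  also have "K powr (1 - p) = X powr (1 - p) * (2 * M) powr (p - 1)"
    using X assms by (simp add: K_def powr_divide powr_diff field_simps powr_mult)
  also have "X powr (p - 1) * (2 * (X powr (1 - p) * (2 * M) powr (p - 1)) * S)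
     = (X powr (p - 1) * X powr (1 - p)) * (2 * 2 powr (p - 1)) * M powr (p - 1) * S"
    using assms by (simp add: powr_mult)
  also have "\<dots> = 2 powr p * M powr (p - 1) * S"
    using X by (simp add: powr_diff field_simps)
  finally show ?thesis .
qed

text \<open>The discrete form of comparison with the integral of \<open>x powr (-\<alpha>)\<close>.
  The inductive step is the concavity estimate \<open>step\<close> for
  \<open>x powr (1 - \<alpha>)\<close> between \<open>N\<close> and \<open>N + 1\<close>.\<close>

lemma sum_powr_neg_le:
  fixes \<alpha> :: real
  assumes "0 < \<alpha>" "\<alpha> < 1"
  shows "(\<Sum>n<N. real (Suc n) powr (-\<alpha>)) \<le> real N powr (1 - \<alpha>) / (1 - \<alpha>)"
proof (induction N)
  case 0
  then show ?case by simp
next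
  case (Suc N)
  define \<beta> where "\<beta> = 1 - \<alpha>"
  have step: "real N powr \<beta> + \<beta> * real (Suc N) powr (-\<alpha>) \<le> real (Suc N) powr \<beta>"
  proof (cases "N = 0")
    case True
    then show ?thesis using assms by (simp add: \<beta>_def)
  next
    case False
    \<comment> \<open>Weighted arithmetic-geometric mean of \<open>N\<close> and
      \<open>N + 1\<close> with weights \<open>\<beta>\<close> and \<open>1 - \<beta>\<close>;
      multiplying by \<open>real (Suc N) powr (-\<alpha>)\<close> afterwards turns it into
      \<open>step\<close>.\<close>
    have "real N powr \<beta> * real (Suc N) powr (1 - \<beta>) \<le> \<beta> * real N + (1 - \<beta>) * real (Suc N)"
      using assms False by (intro Youngs_inequality_0) (auto simp: \<beta>_def)
    also have "\<dots> = real (Suc N) - \<beta>" by (simp add: algebra_simps)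
    finally have "real N powr \<beta> * real (Suc N) powr \<alpha> \<le> real (Suc N) - \<beta>"
      by (simp add: \<beta>_def)
    then have "(real N powr \<beta> * real (Suc N) powr \<alpha>) * real (Suc N) powr (-\<alpha>)
        \<le> (real (Suc N) - \<beta>) * real (Suc N) powr (-\<alpha>)"
      by (intro mult_right_mono) auto
    moreover have "(real N powr \<beta> * real (Suc N) powr \<alpha>) * real (Suc N) powr (-\<alpha>) = real N powr \<beta>"
      by (simp add: mult.assoc flip: powr_add)
    moreover have "real (Suc N) * real (Suc N) powr (-\<alpha>) = real (Suc N) powr \<beta>"
      by (simp add: \<beta>_def powr_diff powr_minus field_simps)
    ultimately show ?thesis by (simp only: left_diff_distrib)
  qed
  have "(\<Sum>n<Suc N. real (Suc n) powr (-\<alpha>)) \<le> real N powr \<beta> / \<beta> + real (Suc N) powr (-\<alpha>)"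
    using Suc by (simp add: \<beta>_def)
  also have "\<dots> = (real N powr \<beta> + \<beta> * real (Suc N) powr (-\<alpha>)) / \<beta>"
    using assms by (simp add: \<beta>_def field_simps)
  also have "\<dots> \<le> real (Suc N) powr \<beta> / \<beta>"
    using step assms by (intro divide_right_mono) (auto simp: \<beta>_def)
  finally show ?case by (simp add: \<beta>_def)
qed

text \<open>The cutoff at a real \<open>y\<close> is what an interchange of sum and integral
  produces: for \<open>t > 0\<close> the condition \<open>t <= 1 / (n + 1)\<close> reads
  \<open>n + 1 <= 1 / t\<close>.\<close>

lemma sum_powr_neg_bounded_le:
  fixes \<alpha> y :: real
  assumes "0 < \<alpha>" "\<alpha> < 1" "0 \<le> y"
  shows "(\<Sum>n<N. if real (Suc n) \<le> y then real (Suc n) powr (-\<alpha>) else 0) \<le> y powr (1 - \<alpha>) / (1 - \<alpha>)"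
proof -
  define M where "M = nat \<lfloor>y\<rfloor>"
  have iff: "real (Suc n) \<le> y \<longleftrightarrow> n < M" for n
    using assms by (simp add: M_def) linarith
  have "(\<Sum>n<N. if real (Suc n) \<le> y then real (Suc n) powr (-\<alpha>) else 0)
      = (\<Sum>n\<in>{..<N} \<inter> {..<M}. real (Suc n) powr (-\<alpha>))"
    by (simp add: iff sum.If_cases lessThan_def del: of_nat_Suc)
  also have "\<dots> \<le> (\<Sum>n<M. real (Suc n) powr (-\<alpha>))"
    by (intro sum_mono2) auto
  also have "\<dots> \<le> real M powr (1 - \<alpha>) / (1 - \<alpha>)"
    by (rule sum_powr_neg_le) fact+
  also have "\<dots> \<le> y powr (1 - \<alpha>) / (1 - \<alpha>)"
    using assms by (intro divide_right_mono powr_mono2) (auto simp: M_def)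
  finally show ?thesis .
qed

text \<open>Hoelder with the weight \<open>t powr (-(1/p))\<close>. It is integrable at 0, which
  gives the factor \<open>p / (p - 1) * x powr ((p - 1) / p)\<close>, and its power
  \<open>1 - p\<close> is \<open>t powr ((p - 1) / p)\<close>, a positive power of \<open>t\<close>
  that later balances a sum over the intervals.\<close>

lemma integral_powr_le_weighted:
  fixes w :: "real \<Rightarrow> real"
  assumes cont: "continuous_on {0..x} w" and nonneg: "\<And>t. t \<in> {0..x} \<Longrightarrow> 0 \<le> w t"
    and x: "0 < x" and p: "1 < p"
  shows "(integral {0..x} w) powr p
    \<le> 2 powr p * (p / (p - 1) * x powr ((p - 1) / p)) powr (p - 1)
      * integral {0..x} (\<lambda>t. w t powr p * t powr ((p - 1) / p))"
proof (rule powr_le_of_parametric_bound)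
  have intg: "(\<lambda>t. w t powr p * t powr ((p - 1) / p)) integrable_on {0..x}"
    using p nonneg by (intro integrable_continuous_interval continuous_on_mult continuous_on_powr' continuous_on_const continuous_on_id cont) auto
  have w: "w integrable_on {0..x}" by (rule integrable_continuous_interval[OF cont])
  show "0 \<le> integral {0..x} w" by (rule integral_nonneg[OF w nonneg])
  show "0 < p / (p - 1) * x powr ((p - 1) / p)" using p x by simp
  show "0 \<le> integral {0..x} (\<lambda>t. w t powr p * t powr ((p - 1) / p))"
    by (rule integral_nonneg[OF intg]) simp
  show "1 < p" by fact
  fix K :: real assume K: "0 < K"
  have hi: "((\<lambda>t. t powr (-(1/p))) has_integral (p / (p - 1) * x powr ((p - 1) / p))) {0..x}"
    using has_integral_powr_from_0[of "-(1/p)" x] p x by (simp add: field_simps)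
  let ?R = "\<lambda>t. K * t powr (-(1/p)) + K powr (1 - p) * (w t powr p * t powr ((p - 1) / p))"
  have R: "(?R has_integral (K * (p / (p - 1) * x powr ((p - 1) / p)) + K powr (1 - p) *
      integral {0..x} (\<lambda>t. w t powr p * t powr ((p - 1) / p)))) {0..x}"
    by (intro has_integral_add has_integral_mult_right hi integrable_integral intg)
  have "(w has_integral integral {0..x} w) {0..x}" using w by (rule integrable_integral)
  \<comment> \<open>At \<open>t = 0\<close> the majorant \<open>?R\<close> is 0, since
    \<open>0 powr y = 0\<close> for every \<open>y\<close>; so the value of \<open>w\<close> there
    is replaced by 0.\<close>
  then have w0: "((\<lambda>t. if t = 0 then 0 else w t) has_integral integral {0..x} w) {0..x}"
    by (rule has_integral_spike_finite[where S="{0}", rotated 2]) auto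
  show "integral {0..x} w \<le> K * (p / (p - 1) * x powr ((p - 1) / p)) + K powr (1 - p) *
      integral {0..x} (\<lambda>t. w t powr p * t powr ((p - 1) / p))"
  proof (rule has_integral_le[OF w0 R])
    fix t assume t: "t \<in> {0..x}"
    show "(if t = 0 then 0 else w t) \<le> ?R t"
    proof (cases "t = 0")
      case False
      have "w t \<le> K * t powr (-(1/p)) + w t powr p * (K * t powr (-(1/p))) powr (1 - p)"
        using False K p nonneg t by (intro le_add_powr_mult_powr) auto
      also have "(K * t powr (-(1/p))) powr (1 - p) = K powr (1 - p) * t powr ((p - 1) / p)"
        using K by (simp add: powr_mult powr_powr diff_divide_distrib algebra_simps)
      finally show ?thesis using False by (simp add: ac_simps)
    qed simp
  qed
qed

text \<open>The substitution x = 1 / n turns this into the classical inequality for the averages of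
  \<open>w\<close> over [0, x]: n^(p - 2) dn becomes x^(-p) dx. After the weighted estimate on each
  interval, sum and integral are interchanged; the sum over \<open>n + 1 <= 1 / t\<close> grows like
  \<open>t powr (-((p - 1) / p))\<close> and cancels the weight exactly. \<open>C\<close> depends on
  \<open>p\<close> alone.\<close>

lemma Hardy_inequality_shrinking_intervals:
  fixes p :: real
  assumes p: "1 < p"
  obtains C where "0 \<le> C"
    "\<And>w N. \<lbrakk>continuous_on {0..1} w; \<forall>t\<in>{0..1}. 0 \<le> w t\<rbrakk> \<Longrightarrow>
      (\<Sum>n<N. real (Suc n) powr (p - 2) * (integral {0..1 / real (Suc n)} w) powr p)
        \<le> C * integral {0..1} (\<lambda>t. w t powr p)"
proof
  define q where "q = p / (p - 1)"
  define C0 where "C0 = 2 powr p * q powr (p - 1)"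
  have q: "q > 0" using p by (simp add: q_def)
  show "0 \<le> C0 * q" using q by (simp add: C0_def)
  fix w :: "real \<Rightarrow> real" and N
  assume cont: "continuous_on {0..1} w" and "\<forall>t\<in>{0..1}. 0 \<le> w t"
  then have nonneg: "\<And>t. t \<in> {0..1} \<Longrightarrow> 0 \<le> w t" by blast
  let ?v = "\<lambda>t. w t powr p * t powr ((p - 1) / p)"
  have vcont: "continuous_on {0..1} ?v"
    using p nonneg by (intro continuous_on_mult continuous_on_powr' continuous_on_const continuous_on_id cont) auto
  have eq: "real (Suc n) powr (p - 2) * (q * (1 / real (Suc n)) powr ((p - 1) / p)) powr (p - 1)
     = q powr (p - 1) * real (Suc n) powr (-(1/p))" for n
  proof -
    \<comment> \<open>The resulting exponent \<open>-(1/p)\<close> lies strictly between -1 and 0,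
      as the power sum estimate requires.\<close>
    have e: "p - 2 - (p - 1) / p * (p - 1) = -(1/p)" using p by (simp add: field_simps)
    have "(1 / real (Suc n)) powr ((p - 1) / p) = real (Suc n) powr (-((p - 1) / p))"
      by (simp only: powr_minus_divide powr_divide) simp
    then have "(q * (1 / real (Suc n)) powr ((p - 1) / p)) powr (p - 1)
        = q powr (p - 1) * real (Suc n) powr (-((p - 1) / p * (p - 1)))"
      using q by (simp add: powr_mult powr_powr)
    then have "real (Suc n) powr (p - 2) * (q * (1 / real (Suc n)) powr ((p - 1) / p)) powr (p - 1)
        = q powr (p - 1) * (real (Suc n) powr (p - 2) * real (Suc n) powr (-((p - 1) / p * (p - 1))))"
      by simp
    also have "\<dots> = q powr (p - 1) * real (Suc n) powr (p - 2 - (p - 1) / p * (p - 1))"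
      by (simp only: powr_add[symmetric]) simp
    finally show ?thesis by (simp only: e)
  qed
  have "(\<Sum>n<N. real (Suc n) powr (p - 2) * (integral {0..1 / real (Suc n)} w) powr p)
     \<le> (\<Sum>n<N. C0 * real (Suc n) powr (-(1/p)) * integral {0..1 / real (Suc n)} ?v)"
  proof (intro sum_mono)
    fix n
    have sub: "{0..1 / real (Suc n)} \<subseteq> {0..1}" by (auto simp: field_simps)
    have "(integral {0..1 / real (Suc n)} w) powr p
      \<le> 2 powr p * (q * (1 / real (Suc n)) powr ((p - 1) / p)) powr (p - 1) * integral {0..1 / real (Suc n)} ?v"
      unfolding q_def using p
      by (intro integral_powr_le_weighted continuous_on_subset[OF cont sub] nonneg[OF subsetD[OF sub]]) auto
    then have "real (Suc n) powr (p - 2) * (integral {0..1 / real (Suc n)} w) powr p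
      \<le> real (Suc n) powr (p - 2) * (2 powr p * (q * (1 / real (Suc n)) powr ((p - 1) / p)) powr (p - 1) * integral {0..1 / real (Suc n)} ?v)"
      by (rule mult_left_mono) auto
    also have "\<dots> = 2 powr p * (real (Suc n) powr (p - 2) * (q * (1 / real (Suc n)) powr ((p - 1) / p)) powr (p - 1)) * integral {0..1 / real (Suc n)} ?v"
      by simp
    also have "\<dots> = C0 * real (Suc n) powr (-(1/p)) * integral {0..1 / real (Suc n)} ?v"
      by (simp only: eq C0_def ac_simps)
    finally show "real (Suc n) powr (p - 2) * (integral {0..1 / real (Suc n)} w) powr p
      \<le> C0 * real (Suc n) powr (-(1/p)) * integral {0..1 / real (Suc n)} ?v" .
  qed
  also have "\<dots> = integral {0..1} (\<lambda>t. \<Sum>n<N. C0 * real (Suc n) powr (-(1/p)) * (if t \<in> {0..1 / real (Suc n)} then ?v t else 0))"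
  proof -
    have hi: "((\<lambda>t. if t \<in> {0..1 / real (Suc n)} then ?v t else 0) has_integral integral {0..1 / real (Suc n)} ?v) {0..1}" for n
    proof (subst has_integral_restrict)
      show sub: "{0..1 / real (Suc n)} \<subseteq> {0..1}" by (auto simp: field_simps)
      show "(?v has_integral integral {0..1 / real (Suc n)} ?v) {0..1 / real (Suc n)}"
        by (intro integrable_integral integrable_continuous_interval continuous_on_subset[OF vcont] sub)
    qed
    have "((\<lambda>t. \<Sum>n<N. C0 * real (Suc n) powr (-(1/p)) * (if t \<in> {0..1 / real (Suc n)} then ?v t else 0))
      has_integral (\<Sum>n<N. C0 * real (Suc n) powr (-(1/p)) * integral {0..1 / real (Suc n)} ?v)) {0..1}"
      by (intro has_integral_sum has_integral_mult_right hi) auto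
    then show ?thesis by (simp only: integral_unique)
  qed
  also have "\<dots> \<le> integral {0..1} (\<lambda>t. C0 * q * w t powr p)"
  proof (rule integral_le)
    show "(\<lambda>t. C0 * q * w t powr p) integrable_on {0..1}"
      using p nonneg by (intro integrable_continuous_interval continuous_on_mult continuous_on_powr' continuous_on_const continuous_on_id cont) auto
    show "(\<lambda>t. \<Sum>n<N. C0 * real (Suc n) powr (-(1/p)) * (if t \<in> {0..1 / real (Suc n)} then ?v t else 0)) integrable_on {0..1}"
    proof (intro integrable_sum integrable_on_mult_right finite_lessThan)
      fix n
      have sub: "{0..1 / real (Suc n)} \<subseteq> {0..1}" by (auto simp: field_simps)
      show "(\<lambda>t. if t \<in> {0..1 / real (Suc n)} then ?v t else 0) integrable_on {0..1}"
        by (subst integrable_restrict_Int, subst Int_absorb2[OF sub])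
          (intro integrable_continuous_interval continuous_on_subset[OF vcont] sub)
    qed
    fix t :: real assume t: "t \<in> {0..1}"
    show "(\<Sum>n<N. C0 * real (Suc n) powr (-(1/p)) * (if t \<in> {0..1 / real (Suc n)} then ?v t else 0))
        \<le> C0 * q * w t powr p"
    proof (cases "t = 0")
      case True
      have "0 \<le> C0 * q * w t powr p" using q by (simp add: C0_def)
      then show ?thesis using True p by (simp cong: if_cong)
    next
      case False
      with t have t0: "t > 0" by simp
      have iff: "t \<le> 1 / real (Suc n) \<longleftrightarrow> real (Suc n) \<le> 1 / t" for n
        using t0 by (simp add: field_simps)
      have "(\<Sum>n<N. C0 * real (Suc n) powr (-(1/p)) * (if t \<in> {0..1 / real (Suc n)} then ?v t else 0))
        = C0 * ?v t * (\<Sum>n<N. if real (Suc n) \<le> 1 / t then real (Suc n) powr (-(1/p)) else 0)"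
        unfolding sum_distrib_left using t0 by (intro sum.cong refl) (simp add: iff del: of_nat_Suc)
      also have "\<dots> \<le> C0 * ?v t * ((1 / t) powr (1 - 1/p) / (1 - 1/p))"
        using p t0 q by (intro mult_left_mono sum_powr_neg_bounded_le) (auto simp: C0_def)
      also have "\<dots> = C0 * q * w t powr p * (t powr ((p - 1) / p) * (1 / t) powr ((p - 1) / p))"
      proof -
        have "1 - 1/p = (p - 1) / p" using p by (simp add: field_simps)
        then show ?thesis by (simp add: q_def)
      qed
      also have "\<dots> = C0 * q * w t powr p"
        using t0 by (simp flip: powr_mult)
      finally show ?thesis .
    qed
  qed
  also have "\<dots> = C0 * q * integral {0..1} (\<lambda>t. w t powr p)" by simp
  finally show "(\<Sum>n<N. real (Suc n) powr (p - 2) * (integral {0..1 / real (Suc n)} w) powr p)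
     \<le> C0 * q * integral {0..1} (\<lambda>t. w t powr p)" .
qed

subsection \<open>Paley's inequality for orthogonal systems\<close>

text \<open>Since (n + 1/2)(n + 3/2) <= (n + 1)^2, each term is at most a difference of consecutive
  values of 1 / (n + 1/2), and the tail telescopes. The shift by one half gives
  \<open>1 / (m + 1/2) <= 2 / (m + 1)\<close> without separating the first term.\<close>

lemma sum_inverse_squares_tail_le:
  fixes x :: real
  assumes x: "0 < x"
  shows "(\<Sum>n<N. if x \<le> real (Suc n) then 1 / (real (Suc n))\<^sup>2 else 0) \<le> 2 / x"
proof -
  define m where "m = nat \<lceil>x\<rceil> - 1"
  have pos: "\<lceil>x\<rceil> \<ge> 1" using x by linarith
  have iff: "x \<le> real (Suc n) \<longleftrightarrow> m \<le> n" for n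
  proof -
    have "x \<le> real (Suc n) \<longleftrightarrow> \<lceil>x\<rceil> \<le> int (Suc n)"
      by (simp add: ceiling_le_iff)
    then show ?thesis using pos unfolding m_def by linarith
  qed
  have xm: "x \<le> real (Suc m)" by (simp only: iff)
  \<comment> \<open>\<open>m\<close> is the first index that is counted; \<open>max m N\<close>
    makes the bound 0 as long as the sum has no nonzero term, so that the induction can start at
    \<open>N = 0\<close>.\<close>
  have tele: "(\<Sum>n<N. if m \<le> n then 1 / (real (Suc n))\<^sup>2 else 0) \<le> 1 / (real m + 1/2) - 1 / (real (max m N) + 1/2)" for N
  proof (induction N)
    case (Suc N)
    show ?case
    proof (cases "m \<le> N")
      case True
      have "1 / (real (Suc N))\<^sup>2 \<le> 1 / ((real N + 1/2) * (real (Suc N) + 1/2))"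
        by (intro frac_le mult_pos_pos) (auto simp: power2_eq_square algebra_simps)
      also have "\<dots> = 1 / (real N + 1/2) - 1 / (real (Suc N) + 1/2)"
        by (simp add: field_simps)
      finally show ?thesis using True Suc by (simp add: max_def split: if_splits)
    next
      case False
      then show ?thesis using Suc by (cases "m = Suc N") auto
    qed
  qed simp
  have "(\<Sum>n<N. if x \<le> real (Suc n) then 1 / (real (Suc n))\<^sup>2 else 0)
      = (\<Sum>n<N. if m \<le> n then 1 / (real (Suc n))\<^sup>2 else 0)" by (simp only: iff)
  also have "\<dots> \<le> 1 / (real m + 1/2)"
    using tele[of N] by (smt (verit) divide_nonneg_nonneg of_nat_0_le_iff)
  also have "\<dots> \<le> 2 / real (Suc m)"
    by (simp add: field_simps)
  also have "\<dots> \<le> 2 / x"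
    using x xm by (intro divide_left_mono) auto
  finally show ?thesis .
qed

text \<open>The integral of \<open>|w - S|^2\<close> is nonnegative, where \<open>S\<close> is the
  projection of \<open>w\<close> to the span of the first \<open>N\<close> functions. The number
  \<open>c\<close> is their common squared norm, and boundedness on a finite measure space makes
  every integral exist.\<close>

lemma (in finite_measure) Bessel_inequality:
  fixes e :: "nat \<Rightarrow> 'a \<Rightarrow> complex" and w :: "'a \<Rightarrow> complex"
  assumes [measurable]: "\<And>n. e n \<in> borel_measurable M" "w \<in> borel_measurable M"
    and e: "\<And>n x. norm (e n x) \<le> 1" and w: "\<And>x. norm (w x) \<le> B"
    and orth: "\<And>m n. (\<integral>x. e m x * cnj (e n x) \<partial>M) = (if m = n then of_real c else 0)"
    and c: "0 < c"
  shows "(\<Sum>n<N. (norm (\<integral>x. w x * cnj (e n x) \<partial>M))\<^sup>2) \<le> c * (\<integral>x. (norm (w x))\<^sup>2 \<partial>M)"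
proof -
  have [measurable]: "(\<lambda>x. cnj (e n x)) \<in> borel_measurable M" for n
    by (rule measurable_compose[OF assms(1)]) (intro borel_measurable_continuous_onI continuous_intros)
  have B: "0 \<le> B" using w norm_ge_zero order_trans by blast
  define y where "y n = (\<integral>x. w x * cnj (e n x) \<partial>M)" for n
  define S where "S x = (1 / of_real c) * (\<Sum>n<N. y n * e n x)" for x
  define Q where "Q = (\<Sum>n<N. (norm (y n))\<^sup>2)"
  have we: "has_bochner_integral M (\<lambda>x. w x * cnj (e n x)) (y n)" for n
    unfolding y_def
  proof (intro has_bochner_integral_integrable integrable_const_bound[where B="B"] AE_I2)
    show "norm (w x * cnj (e n x)) \<le> B" for x
      using mult_mono[OF w[of x] e[of n x]] B by (simp add: norm_mult)
  qed measurable
  have ee: "has_bochner_integral M (\<lambda>x. e m x * cnj (e n x)) (if m = n then of_real c else 0)" for m n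
    unfolding orth[symmetric]
  proof (intro has_bochner_integral_integrable integrable_const_bound[where B="1"] AE_I2)
    show "norm (e m x * cnj (e n x)) \<le> 1" for x
      using mult_mono[OF e[of m x] e[of n x]] by (simp add: norm_mult)
  qed measurable
  have ww: "has_bochner_integral M (\<lambda>x. (norm (w x))\<^sup>2) (\<integral>x. (norm (w x))\<^sup>2 \<partial>M)"
  proof (intro has_bochner_integral_integrable integrable_const_bound[where B="B\<^sup>2"] AE_I2)
    show "norm ((norm (w x))\<^sup>2) \<le> B\<^sup>2" for x
      using w[of x] by (simp add: power_mono)
  qed measurable
  \<comment> \<open>The square \<open>|w - S|^2\<close> is written as a linear combination of
    functions whose integrals are known, so that the value is found by linearity; integrand and
    value are simplified separately below.\<close>
  have "has_bochner_integral M (\<lambda>x. of_real ((norm (w x))\<^sup>2)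
        - (1 / of_real c) * (\<Sum>n<N. cnj (y n) * (w x * cnj (e n x)))
        - (1 / of_real c) * (\<Sum>n<N. y n * cnj (w x * cnj (e n x)))
        + (1 / of_real c)\<^sup>2 * (\<Sum>m<N. \<Sum>n<N. (y m * cnj (y n)) * (e m x * cnj (e n x))))
      (of_real (\<integral>x. (norm (w x))\<^sup>2 \<partial>M)
        - (1 / of_real c) * (\<Sum>n<N. cnj (y n) * y n)
        - (1 / of_real c) * (\<Sum>n<N. y n * cnj (y n))
        + (1 / of_real c)\<^sup>2 * (\<Sum>m<N. \<Sum>n<N. (y m * cnj (y n)) * (if m = n then of_real c else 0)))"
    by (intro has_bochner_integral_add has_bochner_integral_diff has_bochner_integral_mult_right
        has_bochner_integral_sum has_bochner_integral_cnj has_bochner_integral_of_real ww we ee)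
  moreover have "of_real ((norm (w x))\<^sup>2)
        - (1 / of_real c) * (\<Sum>n<N. cnj (y n) * (w x * cnj (e n x)))
        - (1 / of_real c) * (\<Sum>n<N. y n * cnj (w x * cnj (e n x)))
        + (1 / of_real c)\<^sup>2 * (\<Sum>m<N. \<Sum>n<N. (y m * cnj (y n)) * (e m x * cnj (e n x)))
      = of_real ((norm (w x - S x))\<^sup>2)" for x
  proof -
    have 1: "(1 / of_real c) * (\<Sum>n<N. cnj (y n) * (w x * cnj (e n x))) = w x * cnj (S x)"
      by (simp add: S_def sum_distrib_left sum_divide_distrib ac_simps)
    have 2: "(1 / of_real c) * (\<Sum>n<N. y n * cnj (w x * cnj (e n x))) = S x * cnj (w x)"
      by (simp add: S_def sum_distrib_left sum_distrib_right sum_divide_distrib ac_simps)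
    have 3: "(1 / of_real c)\<^sup>2 * (\<Sum>m<N. \<Sum>n<N. (y m * cnj (y n)) * (e m x * cnj (e n x))) = S x * cnj (S x)"
    proof -
      have "S x * cnj (S x) = (1 / of_real c)\<^sup>2 * ((\<Sum>n<N. y n * e n x) * (\<Sum>n<N. cnj (y n * e n x)))"
        by (simp add: S_def power2_eq_square)
      also have "(\<Sum>n<N. y n * e n x) * (\<Sum>n<N. cnj (y n * e n x)) = (\<Sum>m<N. \<Sum>n<N. (y m * cnj (y n)) * (e m x * cnj (e n x)))"
        by (simp add: sum_product ac_simps)
      finally show ?thesis by simp
    qed
    show ?thesis
      unfolding 1 2 3 complex_norm_square by (simp add: algebra_simps)
  qed
  moreover have "of_real (\<integral>x. (norm (w x))\<^sup>2 \<partial>M)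
        - (1 / of_real c) * (\<Sum>n<N. cnj (y n) * y n)
        - (1 / of_real c) * (\<Sum>n<N. y n * cnj (y n))
        + (1 / of_real c)\<^sup>2 * (\<Sum>m<N. \<Sum>n<N. (y m * cnj (y n)) * (if m = n then of_real c else 0))
      = of_real ((\<integral>x. (norm (w x))\<^sup>2 \<partial>M) - Q / c)"
  proof -
    have 1: "(\<Sum>n<N. y n * cnj (y n)) = of_real Q"
      unfolding Q_def of_real_sum by (intro sum.cong refl complex_norm_square[symmetric])
    have 2: "(\<Sum>n<N. cnj (y n) * y n) = of_real Q"
      using 1 by (simp only: mult.commute)
    have "(\<Sum>m<N. \<Sum>n<N. (y m * cnj (y n)) * (if m = n then of_real c else 0)) = (\<Sum>m<N. y m * cnj (y m) * of_real c)"
      by (intro sum.cong refl) (simp add: if_distrib[where f="\<lambda>z. _ * z"] sum.delta cong: if_cong)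
    also have "\<dots> = of_real Q * of_real c"
      by (simp only: sum_distrib_right[symmetric] 1)
    finally show ?thesis
      unfolding 1 2 using c by (simp add: power2_eq_square field_simps)
  qed
  ultimately have "has_bochner_integral M (\<lambda>x. complex_of_real ((norm (w x - S x))\<^sup>2))
      (of_real ((\<integral>x. (norm (w x))\<^sup>2 \<partial>M) - Q / c))"
    by (simp only:)
  then have "has_bochner_integral M (\<lambda>x. (norm (w x - S x))\<^sup>2) ((\<integral>x. (norm (w x))\<^sup>2 \<partial>M) - Q / c)"
    by (drule_tac has_bochner_integral_Re) (simp only: Re_complex_of_real)
  then have "0 \<le> (\<integral>x. (norm (w x))\<^sup>2 \<partial>M) - Q / c"
    by (subst has_bochner_integral_integral_eq[symmetric]) (assumption, simp)
  then show ?thesis using c by (simp add: Q_def y_def field_simps)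
qed

text \<open>The left side is the mass of the indices where (n + 1) times the coefficient reaches
  \<open>t\<close>, for the mass 1 / (n + 1)^2. The large part \<open>v1\<close> contributes at most
  its L^1 norm to each coefficient, the small part \<open>v2\<close> is square summable by
  Bessel.\<close>

lemma (in finite_measure) distribution_of_weighted_coefficients_le:
  fixes e :: "nat \<Rightarrow> 'a \<Rightarrow> complex" and v :: "'a \<Rightarrow> complex"
  assumes [measurable]: "\<And>n. e n \<in> borel_measurable M" "v \<in> borel_measurable M"
    and e: "\<And>n x. norm (e n x) \<le> 1" and v: "\<And>x. norm (v x) \<le> B"
    and orth: "\<And>m n. (\<integral>x. e m x * cnj (e n x) \<partial>M) = (if m = n then of_real c else 0)"
    and c: "0 < c" and t: "0 < t"
  shows "(\<Sum>n<N. if t \<le> real (Suc n) * norm (\<integral>x. v x * cnj (e n x) \<partial>M) then 1 / (real (Suc n))\<^sup>2 else 0)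
    \<le> 4 / t * (\<integral>x. (if t \<le> norm (v x) then norm (v x) else 0) \<partial>M)
      + 4 * c / t\<^sup>2 * (\<integral>x. (if norm (v x) \<le> t then (norm (v x))\<^sup>2 else 0) \<partial>M)"
proof -
  have [measurable]: "(\<lambda>x. cnj (e n x)) \<in> borel_measurable M" for n
    by (rule measurable_compose[OF assms(1)]) (intro borel_measurable_continuous_onI continuous_intros)
  have B: "0 \<le> B" using v norm_ge_zero order_trans by blast
  define v1 where "v1 x = (if t \<le> norm (v x) then v x else 0)" for x
  define v2 where "v2 x = (if t \<le> norm (v x) then 0 else v x)" for x
  have [measurable]: "v1 \<in> borel_measurable M" "v2 \<in> borel_measurable M"
    unfolding v1_def v2_def by measurable
  define I where "I = (\<integral>x. (if t \<le> norm (v x) then norm (v x) else 0) \<partial>M)"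
  have b1: "norm (v1 x) \<le> B" and b2: "norm (v2 x) \<le> B" for x
    using v[of x] B by (auto simp: v1_def v2_def)
  define z where "z n = (\<integral>x. v2 x * cnj (e n x) \<partial>M)" for n
  have int: "integrable M (\<lambda>x. u x * cnj (e n x))" if [measurable]: "u \<in> borel_measurable M" and "\<And>x. norm (u x) \<le> B" for u n
  proof (intro integrable_const_bound[where B="B"] AE_I2)
    show "norm (u x * cnj (e n x)) \<le> B" for x
      using mult_mono[OF that(2)[of x] e[of n x]] B by (simp add: norm_mult)
  qed measurable
  have v1int: "integrable M (\<lambda>x. norm (v1 x))"
    by (intro integrable_const_bound[where B="B"] AE_I2) (use b1 in auto)
  have I: "I = (\<integral>x. norm (v1 x) \<partial>M)"
    unfolding I_def by (intro Bochner_Integration.integral_cong) (auto simp: v1_def)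
  have I0: "I \<ge> 0" unfolding I by (intro Bochner_Integration.integral_nonneg) auto
  have split: "norm (\<integral>x. v x * cnj (e n x) \<partial>M) \<le> I + norm (z n)" for n
  proof -
    have "(\<integral>x. v x * cnj (e n x) \<partial>M) = (\<integral>x. v1 x * cnj (e n x) + v2 x * cnj (e n x) \<partial>M)"
      by (intro Bochner_Integration.integral_cong) (auto simp: v1_def v2_def)
    also have "\<dots> = (\<integral>x. v1 x * cnj (e n x) \<partial>M) + z n"
      unfolding z_def using b1 b2 by (intro Bochner_Integration.integral_add int) auto
    finally have "norm (\<integral>x. v x * cnj (e n x) \<partial>M) \<le> norm (\<integral>x. v1 x * cnj (e n x) \<partial>M) + norm (z n)"
      using norm_triangle_ineq by metis
    moreover have "norm (\<integral>x. v1 x * cnj (e n x) \<partial>M) \<le> I"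
    proof -
      have "norm (\<integral>x. v1 x * cnj (e n x) \<partial>M) \<le> (\<integral>x. norm (v1 x * cnj (e n x)) \<partial>M)"
        by (rule integral_norm_bound)
      also have "\<dots> \<le> I"
        unfolding I using b1
        by (intro integral_mono integrable_norm int v1int) (auto simp: norm_mult intro!: mult_right_le_one_le e)
      finally show ?thesis .
    qed
    ultimately show ?thesis by simp
  qed
  \<comment> \<open>If the total reaches \<open>t\<close>, one of the two parts reaches
    \<open>t / 2\<close>. For the large part this means \<open>n + 1 >= t / (2 * I)\<close>, a tail
    of inverse squares with sum at most \<open>4 * I / t\<close>; for the small part Chebyshev's
    argument gives \<open>4 / t^2\<close> times the squared coefficient.\<close>
  have pt: "(if t \<le> real (Suc n) * norm (\<integral>x. v x * cnj (e n x) \<partial>M) then 1 / (real (Suc n))\<^sup>2 else 0)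
     \<le> (if t / 2 \<le> real (Suc n) * I then 1 / (real (Suc n))\<^sup>2 else 0) + 4 / t\<^sup>2 * (norm (z n))\<^sup>2" for n
  proof (cases "t \<le> real (Suc n) * norm (\<integral>x. v x * cnj (e n x) \<partial>M) \<and> \<not> t / 2 \<le> real (Suc n) * I")
    case True
    have "real (Suc n) * norm (\<integral>x. v x * cnj (e n x) \<partial>M) \<le> real (Suc n) * (I + norm (z n))"
      by (intro mult_left_mono split) auto
    with True have "t / 2 \<le> real (Suc n) * norm (z n)"
      by (simp add: distrib_left del: of_nat_Suc)
    then have "(t / 2)\<^sup>2 \<le> (real (Suc n) * norm (z n))\<^sup>2"
      using t by (intro power_mono) auto
    then have "1 / (real (Suc n))\<^sup>2 \<le> 4 / t\<^sup>2 * (norm (z n))\<^sup>2"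
      using t by (simp add: field_simps power2_eq_square del: of_nat_Suc)
    then show ?thesis using True by simp
  next
    case False
    then show ?thesis by (auto simp del: of_nat_Suc)
  qed
  have "(\<Sum>n<N. if t \<le> real (Suc n) * norm (\<integral>x. v x * cnj (e n x) \<partial>M) then 1 / (real (Suc n))\<^sup>2 else 0)
     \<le> (\<Sum>n<N. if t / 2 \<le> real (Suc n) * I then 1 / (real (Suc n))\<^sup>2 else 0) + 4 / t\<^sup>2 * (\<Sum>n<N. (norm (z n))\<^sup>2)"
    unfolding sum_distrib_left sum.distrib[symmetric] by (intro sum_mono pt)
  also have "\<dots> \<le> 4 / t * I + 4 / t\<^sup>2 * (c * (\<integral>x. (if norm (v x) \<le> t then (norm (v x))\<^sup>2 else 0) \<partial>M))"
  proof (intro add_mono mult_left_mono)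
    show "(\<Sum>n<N. if t / 2 \<le> real (Suc n) * I then 1 / (real (Suc n))\<^sup>2 else 0) \<le> 4 / t * I"
    proof (cases "I = 0")
      case True
      then show ?thesis using t by simp
    next
      case False
      with I0 have "I > 0" by simp
      then have iff: "t / 2 \<le> real (Suc n) * I \<longleftrightarrow> t / (2 * I) \<le> real (Suc n)" for n
        by (simp add: field_simps del: of_nat_Suc)
      have "(\<Sum>n<N. if t / 2 \<le> real (Suc n) * I then 1 / (real (Suc n))\<^sup>2 else 0) \<le> 2 / (t / (2 * I))"
        unfolding iff using t \<open>I > 0\<close> by (intro sum_inverse_squares_tail_le) simp
      then show ?thesis by simp
    qed
    have "(\<Sum>n<N. (norm (z n))\<^sup>2) \<le> c * (\<integral>x. (norm (v2 x))\<^sup>2 \<partial>M)"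
      unfolding z_def by (rule Bessel_inequality[OF _ _ e b2 orth c]) auto
    also have "\<dots> \<le> c * (\<integral>x. (if norm (v x) \<le> t then (norm (v x))\<^sup>2 else 0) \<partial>M)"
    proof (intro mult_left_mono integral_mono)
      show "integrable M (\<lambda>x. (norm (v2 x))\<^sup>2)"
        by (intro integrable_const_bound[where B="B\<^sup>2"] AE_I2) (auto intro!: power_mono b2)
      show "integrable M (\<lambda>x. if norm (v x) \<le> t then (norm (v x))\<^sup>2 else 0)"
        by (intro integrable_const_bound[where B="B\<^sup>2"] AE_I2) (auto intro!: power_mono v)
    qed (use c in \<open>auto simp: v2_def\<close>)
    finally show "(\<Sum>n<N. (norm (z n))\<^sup>2) \<le> c * (\<integral>x. (if norm (v x) \<le> t then (norm (v x))\<^sup>2 else 0) \<partial>M)" .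
  qed simp
  finally show ?thesis by (simp add: I_def)
qed

text \<open>The distribution estimate is integrated against \<open>p * t powr (p - 1)\<close>. On
  the right, Tonelli leads to the integrals of \<open>t powr (p - 2)\<close> over [0, s] and of
  \<open>t powr (p - 3)\<close> over [s, \<infinity>); they converge for \<open>p > 1\<close> and
  \<open>p < 2\<close> respectively and yield the two summands of the constant.\<close>

lemma (in finite_measure) Paley_inequality:
  fixes e :: "nat \<Rightarrow> 'a \<Rightarrow> complex" and v :: "'a \<Rightarrow> complex"
  assumes [measurable]: "\<And>n. e n \<in> borel_measurable M" "v \<in> borel_measurable M"
    and e: "\<And>n x. norm (e n x) \<le> 1" and v: "\<And>x. norm (v x) \<le> B"
    and orth: "\<And>m n. (\<integral>x. e m x * cnj (e n x) \<partial>M) = (if m = n then of_real c else 0)"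
    and c: "0 < c" and p: "1 < p" "p < 2"
  shows "(\<Sum>n<N. real (Suc n) powr (p - 2) * norm (\<integral>x. v x * cnj (e n x) \<partial>M) powr p)
    \<le> (4 * p / (p - 1) + 4 * c * p / (2 - p)) * (\<integral>x. norm (v x) powr p \<partial>M)"
proof -
  have B: "0 \<le> B" using v norm_ge_zero order_trans by blast
  define y where "y n = norm (\<integral>x. v x * cnj (e n x) \<partial>M)" for n
  have y0: "0 \<le> y n" for n by (simp add: y_def)
  define C where "C = 4 * p / (p - 1) + 4 * c * p / (2 - p)"
  have C: "0 \<le> C" using p c by (simp add: C_def)
  \<comment> \<open>the distribution estimate times \<open>p * t powr (p - 1)\<close>, as an integrand over \<open>M\<close>; its
    integral over \<open>t\<close> is \<open>C * s powr p\<close>\<close>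
  define k where "k t s = (if 0 < t then (if t \<le> s then 4 * p * t powr (p - 2) * s else 0)
      + (if s \<le> t then 4 * c * p * t powr (p - 3) * s\<^sup>2 else 0) else 0)" for t s :: real
  have k0: "0 \<le> k t s" if "0 \<le> s" for t s using that p c by (simp add: k_def)
  have [measurable]: "(\<lambda>(t, s). k t s) \<in> borel_measurable (borel \<Otimes>\<^sub>M borel)"
    unfolding k_def by measurable

  have layer: "(\<integral>\<^sup>+t. ennreal (if 0 < t \<and> t \<le> T then p * t powr (p - 1) else 0) \<partial>lborel) = ennreal (T powr p)"
    if "0 \<le> T" for T
  proof (rule nn_integral_has_integral_lborel)
    show "(\<lambda>t. if 0 < t \<and> t \<le> T then p * t powr (p - 1) else 0) \<in> borel_measurable borel"
      by measurable
    have "((\<lambda>t. p * t powr (p - 1)) has_integral p * (T powr (p - 1 + 1) / (p - 1 + 1))) {0..T}"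
      using p that by (intro has_integral_mult_right has_integral_powr_from_0) auto
    then have "((\<lambda>t. if t \<in> {0..T} then p * t powr (p - 1) else 0) has_integral T powr p) UNIV"
      using p by (subst has_integral_restrict_UNIV) simp
    moreover have "(\<lambda>t. if t \<in> {0..T} then p * t powr (p - 1) else 0) = (\<lambda>t. if 0 < t \<and> t \<le> T then p * t powr (p - 1) else 0)"
      using p by (auto simp: fun_eq_iff)
    ultimately show "((\<lambda>t. if 0 < t \<and> t \<le> T then p * t powr (p - 1) else 0) has_integral T powr p) UNIV"
      by simp
  qed (use p in auto)

  have kint: "(\<integral>\<^sup>+t. ennreal (k t s) \<partial>lborel) = ennreal (C * s powr p)" if "0 \<le> s" for s
  proof (cases "s = 0")
    case True
    have "k t 0 = 0" for t by (simp add: k_def)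
    then show ?thesis using True p by simp
  next
    case False
    with that have s: "0 < s" by simp
    show ?thesis
    proof (rule nn_integral_has_integral_lborel)
      show "(\<lambda>t. k t s) \<in> borel_measurable borel" by measurable
      show "0 \<le> k t s" for t using s by (intro k0) simp
      have 1: "((\<lambda>t. if t \<in> {0..s} then 4 * p * s * t powr (p - 2) else 0) has_integral 4 * p * s * (s powr (p - 2 + 1) / (p - 2 + 1))) UNIV"
        using p s by (subst has_integral_restrict_UNIV) (intro has_integral_mult_right has_integral_powr_from_0, auto)
      have 2: "((\<lambda>t. if t \<in> {s..} then 4 * c * p * s\<^sup>2 * t powr (p - 3) else 0) has_integral 4 * c * p * s\<^sup>2 * (- (s powr (p - 3 + 1)) / (p - 3 + 1))) UNIV"
        using p s by (subst has_integral_restrict_UNIV) (intro has_integral_mult_right has_integral_powr_to_inf, auto)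
      have "s * s powr (p - 2 + 1) = s powr p" "s\<^sup>2 * s powr (p - 3 + 1) = s powr p"
        using s by (simp_all add: powr_diff power2_eq_square field_simps)
      then have "4 * p * s * (s powr (p - 2 + 1) / (p - 2 + 1)) + 4 * c * p * s\<^sup>2 * (- (s powr (p - 3 + 1)) / (p - 3 + 1))
         = 4 * p * s powr p / (p - 1) + 4 * c * p * s powr p / (2 - p)"
        using p by (simp add: mult.assoc) (simp add: divide_simps, simp add: algebra_simps)
      also have "\<dots> = C * s powr p"
        by (simp add: C_def algebra_simps)
      finally have eq: "4 * p * s * (s powr (p - 2 + 1) / (p - 2 + 1)) + 4 * c * p * s\<^sup>2 * (- (s powr (p - 3 + 1)) / (p - 3 + 1)) = C * s powr p" .
      have fn: "(\<lambda>t. (if t \<in> {0..s} then 4 * p * s * t powr (p - 2) else 0) + (if t \<in> {s..} then 4 * c * p * s\<^sup>2 * t powr (p - 3) else 0)) = (\<lambda>t. k t s)"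
        using s by (auto simp: fun_eq_iff k_def)
      show "((\<lambda>t. k t s) has_integral C * s powr p) UNIV"
        using has_integral_add[OF 1 2] unfolding eq fn .
    qed
  qed

  have main: "(\<Sum>n<N. if 0 < t \<and> t \<le> real (Suc n) * y n then 1 / (real (Suc n))\<^sup>2 * (p * t powr (p - 1)) else 0)
     \<le> (\<integral>x. k t (norm (v x)) \<partial>M)" for t
  proof (cases "0 < t")
    case True
    let ?f1 = "\<lambda>x. if t \<le> norm (v x) then norm (v x) else 0"
    let ?f2 = "\<lambda>x. if norm (v x) \<le> t then (norm (v x))\<^sup>2 else 0"
    have i1: "integrable M ?f1"
      using v B by (intro integrable_const_bound[where B="B"] AE_I2) auto
    have i2: "integrable M ?f2"
      by (intro integrable_const_bound[where B="B\<^sup>2"] AE_I2) (auto intro!: power_mono v)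
    have "(\<Sum>n<N. if 0 < t \<and> t \<le> real (Suc n) * y n then 1 / (real (Suc n))\<^sup>2 * (p * t powr (p - 1)) else 0)
       = p * t powr (p - 1) * (\<Sum>n<N. if t \<le> real (Suc n) * y n then 1 / (real (Suc n))\<^sup>2 else 0)"
      unfolding sum_distrib_left using True by (intro sum.cong refl) (simp del: of_nat_Suc)
    also have "\<dots> \<le> p * t powr (p - 1) * (4 / t * (\<integral>x. ?f1 x \<partial>M) + 4 * c / t\<^sup>2 * (\<integral>x. ?f2 x \<partial>M))"
      unfolding y_def using p True
      by (intro mult_left_mono distribution_of_weighted_coefficients_le[OF _ _ e v orth c]) auto
    also have "\<dots> = 4 * p * t powr (p - 2) * (\<integral>x. ?f1 x \<partial>M) + 4 * c * p * t powr (p - 3) * (\<integral>x. ?f2 x \<partial>M)"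
    proof -
      have A: "t powr (p - 1) / t = t powr (p - 2)" "t powr (p - 1) / t\<^sup>2 = t powr (p - 3)"
        using True by (simp_all add: powr_diff power2_eq_square power3_eq_cube)
      have "p * t powr (p - 1) * (4 / t * X + 4 * c / t\<^sup>2 * Y)
          = 4 * p * (t powr (p - 1) / t) * X + 4 * c * p * (t powr (p - 1) / t\<^sup>2) * Y" for X Y
        by (simp add: distrib_left mult_ac)
      then show ?thesis by (simp only: A)
    qed
    also have "\<dots> = (\<integral>x. 4 * p * t powr (p - 2) * ?f1 x + 4 * c * p * t powr (p - 3) * ?f2 x \<partial>M)"
      by (subst Bochner_Integration.integral_add) ((intro integrable_mult_right i1 i2)+, simp only: integral_mult_right_zero)
    also have "\<dots> = (\<integral>x. k t (norm (v x)) \<partial>M)"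
      using True by (intro Bochner_Integration.integral_cong) (auto simp: k_def)
    finally show ?thesis .
  next
    case False
    then show ?thesis by (simp add: k_def)
  qed

  have kM: "ennreal (\<integral>x. k t (norm (v x)) \<partial>M) = (\<integral>\<^sup>+x. ennreal (k t (norm (v x))) \<partial>M)" for t
  proof (rule nn_integral_eq_integral[symmetric])
    have "k t (norm (v x)) \<le> \<bar>4 * p * t powr (p - 2) * B\<bar> + \<bar>4 * c * p * t powr (p - 3) * B\<^sup>2\<bar>" for x
    proof -
      have "4 * p * t powr (p - 2) * norm (v x) \<le> 4 * p * t powr (p - 2) * B"
        using p v by (intro mult_left_mono) auto
      moreover have "4 * c * p * t powr (p - 3) * (norm (v x))\<^sup>2 \<le> 4 * c * p * t powr (p - 3) * B\<^sup>2"
        using p c v by (intro mult_left_mono power_mono) auto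
      ultimately show ?thesis
        by (simp only: k_def split: if_split) (intro conjI impI; linarith)
    qed
    then show "integrable M (\<lambda>x. k t (norm (v x)))"
      using k0 by (intro integrable_const_bound[where B="\<bar>4 * p * t powr (p - 2) * B\<bar> + \<bar>4 * c * p * t powr (p - 3) * B\<^sup>2\<bar>"] AE_I2) auto
  qed (use k0 in auto)

  \<comment> \<open>Working in the extended nonnegative reals lets the sum and the two integrals be
    interchanged without a prior integrability proof on the product space.\<close>
  have "ennreal (\<Sum>n<N. real (Suc n) powr (p - 2) * y n powr p)
      = (\<Sum>n<N. ennreal (1 / (real (Suc n))\<^sup>2) * ennreal ((real (Suc n) * y n) powr p))"
  proof -
    have "real (Suc n) powr (p - 2) * y n powr p = 1 / (real (Suc n))\<^sup>2 * (real (Suc n) * y n) powr p" for n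
      using y0[of n] by (simp add: powr_mult powr_diff)
    then show ?thesis
      by (subst sum_ennreal[symmetric]) (auto intro!: sum.cong simp: ennreal_mult[symmetric] simp del: of_nat_Suc)
  qed
  also have "\<dots> = (\<Sum>n<N. (\<integral>\<^sup>+t. ennreal (1 / (real (Suc n))\<^sup>2) * ennreal (if 0 < t \<and> t \<le> real (Suc n) * y n then p * t powr (p - 1) else 0) \<partial>lborel))"
    using y0 by (intro sum.cong refl) (subst nn_integral_cmult, simp_all add: layer)
  also have "\<dots> = (\<integral>\<^sup>+t. (\<Sum>n<N. ennreal (1 / (real (Suc n))\<^sup>2) * ennreal (if 0 < t \<and> t \<le> real (Suc n) * y n then p * t powr (p - 1) else 0)) \<partial>lborel)"
    by (rule nn_integral_sum[symmetric]) measurable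
  also have "\<dots> \<le> (\<integral>\<^sup>+t. (\<integral>\<^sup>+x. ennreal (k t (norm (v x))) \<partial>M) \<partial>lborel)"
  proof (intro nn_integral_mono)
    fix t :: real
    have "(\<Sum>n<N. ennreal (1 / (real (Suc n))\<^sup>2) * ennreal (if 0 < t \<and> t \<le> real (Suc n) * y n then p * t powr (p - 1) else 0))
       = ennreal (\<Sum>n<N. if 0 < t \<and> t \<le> real (Suc n) * y n then 1 / (real (Suc n))\<^sup>2 * (p * t powr (p - 1)) else 0)"
      using p by (subst sum_ennreal[symmetric]) (auto intro!: sum.cong arg_cong[where f=ennreal] simp: ennreal_mult[symmetric] simp del: of_nat_Suc)
    also have "\<dots> \<le> ennreal (\<integral>x. k t (norm (v x)) \<partial>M)"
      by (intro ennreal_leI main)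
    finally show "(\<Sum>n<N. ennreal (1 / (real (Suc n))\<^sup>2) * ennreal (if 0 < t \<and> t \<le> real (Suc n) * y n then p * t powr (p - 1) else 0))
       \<le> (\<integral>\<^sup>+x. ennreal (k t (norm (v x))) \<partial>M)" by (simp only: kM)
  qed
  also have "\<dots> = (\<integral>\<^sup>+x. (\<integral>\<^sup>+t. ennreal (k t (norm (v x))) \<partial>lborel) \<partial>M)"
  proof -
    interpret P: pair_sigma_finite lborel M ..
    have "(\<lambda>(t, x). ennreal (k t (norm (v x)))) \<in> borel_measurable (lborel \<Otimes>\<^sub>M M)"
      by measurable
    then show ?thesis by (rule P.Fubini'[symmetric])
  qed
  also have "\<dots> = (\<integral>\<^sup>+x. ennreal (C * norm (v x) powr p) \<partial>M)"
    by (simp add: kint)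
  also have "\<dots> = ennreal (\<integral>x. C * norm (v x) powr p \<partial>M)"
    using C p v
    by (intro nn_integral_eq_integral integrable_mult_right integrable_const_bound[where B="B powr p"] AE_I2) (auto intro!: powr_mono2)
  also have "(\<integral>x. C * norm (v x) powr p \<partial>M) = C * (\<integral>x. norm (v x) powr p \<partial>M)"
    by simp
  finally have "ennreal (\<Sum>n<N. real (Suc n) powr (p - 2) * y n powr p) \<le> ennreal (C * (\<integral>x. norm (v x) powr p \<partial>M))" .
  then show ?thesis
    using C by (subst (asm) ennreal_le_iff) (auto simp: y_def C_def)
qed

subsection \<open>Fourier coefficients on circles\<close>

lemma integral_cis_of_int:
  "integral {0..2*pi} (\<lambda>t. cis (of_int k * t)) = (if k = 0 then of_real (2 * pi) else 0)"
proof (cases "k = 0")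
  case True
  then show ?thesis by (simp add: scaleR_conv_of_real)
next
  case False
  define F where "F t = cis (of_int k * t) / (\<i> * of_int k)" for t
  have "((\<lambda>t. cis (of_int k * t)) has_integral F (2 * pi) - F 0) {0..2*pi}"
  proof (rule fundamental_theorem_of_calculus)
    show "(F has_vector_derivative cis (of_int k * t)) (at t within {0..2*pi})" for t
    proof -
      have "((\<lambda>z. exp (\<i> * of_int k * z) / (\<i> * of_int k)) has_field_derivative exp (\<i> * of_int k * z)) (at z)" for z :: complex
        using False by (auto intro!: derivative_eq_intros)
      from has_vector_derivative_real_field[OF this, of t]
      show ?thesis unfolding F_def by (simp add: cis_conv_exp mult_ac o_def)
    qed
  qed simp
  moreover have "F (2 * pi) = F 0"
  proof -
    have "cis (of_int k * (2 * pi)) = 1"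
      using cis_multiple_2pi[of "of_int k"] by (simp add: mult_ac)
    then show ?thesis by (simp add: F_def)
  qed
  ultimately show ?thesis using False by (simp add: integral_unique)
qed

lemma summable_norm_powser_inside_disc:
  fixes a :: "nat \<Rightarrow> complex" and h :: "complex \<Rightarrow> complex"
  assumes sums: "\<And>z. z \<in> ball 0 1 \<Longrightarrow> (\<lambda>n. a n * z ^ n) sums h z" and r: "0 \<le> r" "r < 1"
  shows "summable (\<lambda>n. norm (a n) * r ^ n)"
proof -
  \<comment> \<open>The midpoint of \<open>r\<close> and 1 is a point of convergence strictly
    outside the circle of radius \<open>r\<close>.\<close>
  have "summable (\<lambda>n. a n * (of_real ((1 + r) / 2)) ^ n)"
    using r by (intro sums_summable[OF sums]) (simp del: of_real_divide of_real_add)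
  then have "summable (\<lambda>n. norm (a n * of_real r ^ n))"
    by (rule powser_insidea) (use r in \<open>simp del: of_real_divide of_real_add\<close>)
  then show ?thesis using r by (simp add: norm_mult norm_power)
qed

text \<open>Uniform convergence on a circle inside the disc permits termwise integration. The test
  function is left general: it will be a character, the sawtooth \<open>pi - t\<close>, or the
  tent.\<close>

lemma powser_circle_pairing_sums:
  fixes a :: "nat \<Rightarrow> complex" and h \<phi> :: "_ \<Rightarrow> complex"
  assumes sums: "\<And>z. z \<in> ball 0 1 \<Longrightarrow> (\<lambda>n. a n * z ^ n) sums h z"
    and r: "0 \<le> r" "r < 1" and \<phi>: "continuous_on {0..2*pi} \<phi>"
  shows "(\<lambda>n. a n * of_real r ^ n * integral {0..2*pi} (\<lambda>t. cis (real n * t) * \<phi> t))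
    sums integral {0..2*pi} (\<lambda>t. h (of_real r * cis t) * \<phi> t)"
proof -
  have "bounded (\<phi> ` {0..2*pi})"
    by (intro compact_imp_bounded compact_continuous_image \<phi>) simp
  then obtain K where K: "\<And>t. t \<in> {0..2*pi} \<Longrightarrow> norm (\<phi> t) \<le> K"
    unfolding bounded_iff by blast
  define u where "u n t = a n * of_real r ^ n * (cis (real n * t) * \<phi> t)" for n t
  have u_sums: "(\<lambda>n. u n t) sums (h (of_real r * cis t) * \<phi> t)" for t
  proof -
    have "(\<lambda>n. a n * (of_real r * cis t) ^ n * \<phi> t) sums (h (of_real r * cis t) * \<phi> t)"
      using r by (intro sums_mult2 sums) (simp add: norm_mult)
    then show ?thesis by (simp add: u_def power_mult_distrib Complex.DeMoivre mult_ac)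
  qed
  have "uniform_limit {0..2*pi} (\<lambda>n t. \<Sum>i<n. u i t) (\<lambda>t. \<Sum>i. u i t) sequentially"
  proof (rule Weierstrass_m_test)
    show "norm (u n t) \<le> norm (a n) * r ^ n * K" if "t \<in> {0..2*pi}" for n t
      using K[OF that] r by (simp add: u_def norm_mult norm_power mult_left_mono)
    show "summable (\<lambda>n. norm (a n) * r ^ n * K)"
      by (intro summable_mult2 summable_norm_powser_inside_disc[OF sums r])
  qed
  then have lim: "uniform_limit {0..2*pi} (\<lambda>n t. \<Sum>i<n. u i t) (\<lambda>t. h (of_real r * cis t) * \<phi> t) sequentially"
    by (simp only: sums_unique[OF u_sums, symmetric])
  have cont: "continuous_on {0..2*pi} (u i)" for i
    unfolding u_def by (intro continuous_intros \<phi>)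
  have cont_sum: "continuous_on {0..2*pi} (\<lambda>t. \<Sum>i<n. u i t)" for n
    by (intro continuous_on_sum cont)
  obtain I J where I: "\<And>n. ((\<lambda>t. \<Sum>i<n. u i t) has_integral I n) {0..2*pi}"
    and J: "((\<lambda>t. h (of_real r * cis t) * \<phi> t) has_integral J) {0..2*pi}" and IJ: "I \<longlonglongrightarrow> J"
    by (rule uniform_limit_integral[OF lim cont_sum]) auto
  have "I n = (\<Sum>i<n. a i * of_real r ^ i * integral {0..2*pi} (\<lambda>t. cis (real i * t) * \<phi> t))" for n
  proof -
    have "I n = integral {0..2*pi} (\<lambda>t. \<Sum>i<n. u i t)"
      by (rule integral_unique[OF I, symmetric])
    also have "\<dots> = (\<Sum>i<n. integral {0..2*pi} (u i))"
      by (intro integral_sum integrable_continuous_interval cont) auto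
    finally show ?thesis by (simp add: u_def[abs_def])
  qed
  then have "I = (\<lambda>n. \<Sum>i<n. a i * of_real r ^ i * integral {0..2*pi} (\<lambda>t. cis (real i * t) * \<phi> t))"
    by (intro ext)
  with IJ integral_unique[OF J] show ?thesis by (simp add: sums_def)
qed

lemma powser_circle_coefficient:
  fixes a :: "nat \<Rightarrow> complex" and h :: "complex \<Rightarrow> complex"
  assumes sums: "\<And>z. z \<in> ball 0 1 \<Longrightarrow> (\<lambda>n. a n * z ^ n) sums h z"
    and r: "0 \<le> r" "r < 1"
  shows "integral {0..2*pi} (\<lambda>t. h (of_real r * cis t) * cis (of_int k * t))
    = (if k \<le> 0 then 2 * pi * a (nat (-k)) * of_real r ^ nat (-k) else 0)"
proof -
  have "(\<lambda>n. a n * of_real r ^ n * integral {0..2*pi} (\<lambda>t. cis (real n * t) * cis (of_int k * t)))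
    sums integral {0..2*pi} (\<lambda>t. h (of_real r * cis t) * cis (of_int k * t))"
    by (intro powser_circle_pairing_sums[OF sums r] continuous_intros)
  moreover have "integral {0..2*pi} (\<lambda>t. cis (real n * t) * cis (of_int k * t)) = (if int n = - k then of_real (2 * pi) else 0)" for n
  proof -
    have "integral {0..2*pi} (\<lambda>t. cis (real n * t) * cis (of_int k * t)) = integral {0..2*pi} (\<lambda>t. cis (of_int (int n + k) * t))"
      by (simp add: cis_mult distrib_right)
    also have "\<dots> = (if int n = - k then of_real (2 * pi) else 0)"
      unfolding integral_cis_of_int by (simp add: eq_neg_iff_add_eq_0)
    finally show ?thesis .
  qed
  ultimately have s: "(\<lambda>n. a n * of_real r ^ n * (if int n = - k then of_real (2 * pi) else 0))
    sums integral {0..2*pi} (\<lambda>t. h (of_real r * cis t) * cis (of_int k * t))" by simp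
  show ?thesis
  proof (cases "k \<le> 0")
    case True
    have "(\<lambda>n. a n * of_real r ^ n * (if int n = - k then of_real (2 * pi) else 0))
       = (\<lambda>n. if n = nat (-k) then a n * of_real r ^ n * of_real (2 * pi) else 0)"
      using True by (auto simp: fun_eq_iff)
    with s have "(\<lambda>n. if n = nat (-k) then a n * of_real r ^ n * of_real (2 * pi) else 0)
      sums integral {0..2*pi} (\<lambda>t. h (of_real r * cis t) * cis (of_int k * t))" by simp
    from sums_unique2[OF this sums_single] show ?thesis using True by (simp add: mult_ac)
  next
    case False
    then have "(\<lambda>n. a n * of_real r ^ n * (if int n = - k then of_real (2 * pi) else 0)) = (\<lambda>n. 0)"
      by (auto simp: fun_eq_iff)
    with s have "(\<lambda>n. 0) sums integral {0..2*pi} (\<lambda>t. h (of_real r * cis t) * cis (of_int k * t))" by simp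
    from sums_unique2[OF this sums_zero] show ?thesis using False by simp
  qed
qed

lemma continuous_on_circle:
  fixes f :: "complex \<Rightarrow> 'a::topological_space"
  assumes "continuous_on (ball 0 1) f" "0 \<le> r" "r < 1"
  shows "continuous_on A (\<lambda>t. f (of_real r * cis t))"
  by (rule continuous_on_compose2[OF assms(1)])
    (use assms in \<open>auto intro!: continuous_intros simp: norm_mult\<close>)

text \<open>A character of frequency \<open>-n\<close> sees only \<open>h\<close> and one of
  frequency \<open>n\<close> only the conjugate of \<open>g\<close>, except at \<open>n = 0\<close>,
  where they meet. There \<open>b 0 = 0\<close> keeps the first statement an equality, while the
  second has 0 on its left and in general not on its right; hence the inequality.\<close>

lemma harmonic_circle_coefficients:
  fixes a b :: "nat \<Rightarrow> complex" and h g :: "complex \<Rightarrow> complex"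
  assumes a: "\<And>z. z \<in> ball 0 1 \<Longrightarrow> (\<lambda>n. a n * z ^ n) sums h z"
    and b: "\<And>z. z \<in> ball 0 1 \<Longrightarrow> (\<lambda>n. b n * z ^ n) sums g z"
    and cont: "continuous_on (ball 0 1) h" "continuous_on (ball 0 1) g"
    and b0: "b 0 = 0" and r: "0 \<le> r" "r < 1"
  defines "F \<equiv> (\<lambda>t. h (of_real r * cis t) + cnj (g (of_real r * cis t)))"
  shows "norm (integral {0..2*pi} (\<lambda>t. F t * cis (- (real n * t)))) = 2 * pi * (norm (a n) * r ^ n)"
    and "2 * pi * (norm (b n) * r ^ n) \<le> norm (integral {0..2*pi} (\<lambda>t. F t * cis (real n * t)))"
proof -
  have split: "integral {0..2*pi} (\<lambda>t. F t * cis (of_int k * t))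
      = (if k \<le> 0 then 2 * pi * a (nat (-k)) * of_real r ^ nat (-k) else 0)
        + cnj (if - k \<le> 0 then 2 * pi * b (nat k) * of_real r ^ nat k else 0)" for k
  proof -
    have "integral {0..2*pi} (\<lambda>t. F t * cis (of_int k * t)) = integral {0..2*pi} (\<lambda>t.
       h (of_real r * cis t) * cis (of_int k * t) + cnj (g (of_real r * cis t) * cis (of_int (- k) * t)))"
      by (simp add: F_def distrib_right cis_cnj)
    also have "\<dots> = integral {0..2*pi} (\<lambda>t. h (of_real r * cis t) * cis (of_int k * t))
       + integral {0..2*pi} (\<lambda>t. cnj (g (of_real r * cis t) * cis (of_int (- k) * t)))"
      by (intro Henstock_Kurzweil_Integration.integral_add integrable_continuous_interval continuous_intros continuous_on_circle cont r)
    also have "integral {0..2*pi} (\<lambda>t. cnj (g (of_real r * cis t) * cis (of_int (- k) * t)))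
        = cnj (integral {0..2*pi} (\<lambda>t. g (of_real r * cis t) * cis (of_int (- k) * t)))"
      by (rule integral_cnj[symmetric])
    finally show ?thesis
      by (simp only: powser_circle_coefficient[OF a r, of k] powser_circle_coefficient[OF b r, of "-k"] minus_minus)
  qed
  have "integral {0..2*pi} (\<lambda>t. F t * cis (- (real n * t))) = 2 * pi * a n * of_real r ^ n"
    using split[of "- int n"] b0 by (cases "n = 0") auto
  then show "norm (integral {0..2*pi} (\<lambda>t. F t * cis (- (real n * t)))) = 2 * pi * (norm (a n) * r ^ n)"
    using r by (simp add: norm_mult norm_power)
  show "2 * pi * (norm (b n) * r ^ n) \<le> norm (integral {0..2*pi} (\<lambda>t. F t * cis (real n * t)))"
    using split[of "int n"] b0 r by (cases "n = 0") (auto simp: norm_mult norm_power)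
qed

text \<open>For fixed \<open>N\<close> the sum is finite, so the limit \<open>r -> 1\<close> can be
  taken inside; the bound \<open>B\<close> survives and does not depend on \<open>N\<close>.
  Positivity of \<open>p\<close> gives continuity of the power also where
  \<open>c n = 0\<close>.\<close>

lemma summable_of_bounded_dilations:
  fixes w c :: "nat \<Rightarrow> real"
  assumes w: "\<And>n. 0 \<le> w n" and c: "\<And>n. 0 \<le> c n" and p: "0 < p" and r0: "r0 < 1"
    and bound: "\<And>r N. \<lbrakk>r0 < r; r < 1\<rbrakk> \<Longrightarrow> (\<Sum>n<N. w n * (c n * r ^ n) powr p) \<le> B"
  shows "summable (\<lambda>n. w n * c n powr p)"
proof (rule summableI_nonneg_bounded)
  show "0 \<le> w n * c n powr p" for n using w by simp
  fix N
  have lim: "((\<lambda>r::real. \<Sum>n<N. w n * (c n * r ^ n) powr p) \<longlongrightarrow> (\<Sum>n<N. w n * (c n * 1 ^ n) powr p)) (at_left 1)"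
    by (intro tendsto_sum tendsto_mult tendsto_const tendsto_powr' tendsto_power tendsto_ident_at)
      (use p c in \<open>auto simp: eventually_at_left_field intro!: exI[of _ 0]\<close>)
  have "(\<Sum>n<N. w n * (c n * 1 ^ n) powr p) \<le> B"
  proof (rule tendsto_upperbound[OF lim])
    show "\<forall>\<^sub>F r in at_left 1. (\<Sum>n<N. w n * (c n * r ^ n) powr p) \<le> B"
      unfolding eventually_at_left_field using r0 bound by (intro exI[of _ r0]) auto
  qed simp
  then show "(\<Sum>n<N. w n * c n powr p) \<le> B" by simp
qed

text \<open>Near 1 the means lie below their limit plus one. Only radii beyond some
  \<open>r0\<close> are controlled, which suffices because the radius will tend to 1.\<close>

lemma harmonic_hardy_integral_bound:
  assumes f: "f \<in> harmonic_hardy p" and cont: "continuous_on (ball 0 1) f" and p: "0 < p"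
  obtains B r0 where "0 \<le> r0" "r0 < 1"
    "\<And>r. \<lbrakk>r0 < r; r < 1\<rbrakk> \<Longrightarrow> integral {0..2*pi} (\<lambda>t. norm (f (of_real r * cis t)) powr p) \<le> B"
proof -
  from f obtain L where L: "((\<lambda>r. integral_mean p r f) \<longlongrightarrow> L) (at_left 1)"
    by (auto simp: harmonic_hardy_def)
  then have "\<forall>\<^sub>F r in at_left 1. integral_mean p r f < L + 1"
    by (rule order_tendstoD) simp
  then obtain r1 where r1: "r1 < 1" "\<And>r. \<lbrakk>r1 < r; r < 1\<rbrakk> \<Longrightarrow> integral_mean p r f < L + 1"
    unfolding eventually_at_left_field by auto
  show ?thesis
  proof
    show "0 \<le> max r1 0" "max r1 0 < 1" using r1 by auto
    fix r assume r: "max r1 0 < r" "r < 1"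
    define I where "I = integral {0..2*pi} (\<lambda>t. norm (f (of_real r * cis t)) powr p)"
    have I: "0 \<le> I" unfolding I_def
      using r p by (intro integral_nonneg integrable_continuous_interval continuous_on_powr'
        continuous_intros continuous_on_circle cont) auto
    have "(1 / (2 * pi) * I) powr (1 / p) \<le> L + 1"
      using r1(2)[of r] r by (simp add: integral_mean_def I_def)
    then have "((1 / (2 * pi) * I) powr (1 / p)) powr p \<le> (L + 1) powr p"
      using p by (intro powr_mono2) auto
    then have "1 / (2 * pi) * I \<le> (L + 1) powr p"
      using p I by (simp add: powr_powr)
    then show "I \<le> 2 * pi * (L + 1) powr p" by (simp add: field_simps)
  qed
qed

lemma powr_add_le_two_powr:
  fixes x y p :: real
  assumes "0 \<le> x" "0 \<le> y" "0 \<le> p"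
  shows "(x + y) powr p \<le> 2 powr p * (x powr p + y powr p)"
proof -
  have "(x + y) powr p \<le> (2 * max x y) powr p"
    using assms by (intro powr_mono2) auto
  also have "\<dots> = 2 powr p * max x y powr p"
    using assms by (simp add: powr_mult)
  also have "\<dots> \<le> 2 powr p * (x powr p + y powr p)"
    by (intro mult_left_mono) (auto simp: max_def)
  finally show ?thesis .
qed

lemma Re_integral: "f integrable_on S \<Longrightarrow> Re (integral S f) = integral S (\<lambda>x. Re (f x))"
  using integral_linear[OF _ bounded_linear_Re, of f S] by (simp add: o_def)

lemma Im_integral: "f integrable_on S \<Longrightarrow> Im (integral S f) = integral S (\<lambda>x. Im (f x))"
  using integral_linear[OF _ bounded_linear_Im, of f S] by (simp add: o_def)

lemma sum_le_sums_nonneg: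
  fixes f :: "nat \<Rightarrow> real"
  assumes "f sums s" "finite I" "\<And>n. 0 \<le> f n"
  shows "sum f I \<le> s"
  using sum_le_suminf[of f I] assms by (auto simp: sums_iff)

lemma integral_lebesgue_on_continuous:
  fixes u :: "real \<Rightarrow> 'a::euclidean_space"
  assumes "continuous_on {a..b} u"
  shows "integral\<^sup>L (lebesgue_on {a..b}) u = integral {a..b} u"
  using assms
  by (intro lebesgue_integral_eq_integral absolutely_integrable_imp_integrable absolutely_integrable_continuous_real) auto

text \<open>The sign \<open>s\<close> selects the frequencies, so one constant serves the
  coefficients of \<open>h\<close> and of \<open>g\<close>. At \<open>p = 2\<close> the
  interpolation constant is infinite; there the weight is 1 and Bessel's inequality is the claim
  itself, with \<open>2 * pi\<close> the squared norm of a character.\<close>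

lemma Hardy_Littlewood_Fourier_coefficients:
  fixes p :: real
  assumes p: "1 < p" "p \<le> 2"
  obtains C where "0 \<le> C"
    "\<And>v s N. \<lbrakk>continuous_on UNIV v; bounded (range v); \<bar>s\<bar> = 1\<rbrakk> \<Longrightarrow>
      (\<Sum>n<N. real (Suc n) powr (p - 2) * norm (integral {0..2*pi} (\<lambda>t. v t * cis (s * (real n * t)))) powr p)
        \<le> C * integral {0..2*pi} (\<lambda>t. norm (v t) powr p)"
proof
  define C where "C = (if p = 2 then 2 * pi else 4 * p / (p - 1) + 4 * (2 * pi) * p / (2 - p))"
  show "0 \<le> C" using p by (simp add: C_def)
  fix v :: "real \<Rightarrow> complex" and s :: real and N
  assume v: "continuous_on UNIV v" "bounded (range v)" and s: "\<bar>s\<bar> = 1"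
  obtain B where B: "\<And>t. norm (v t) \<le> B" using v(2) unfolding bounded_iff by auto
  have vc: "continuous_on A v" for A using v(1) by (rule continuous_on_subset) simp
  interpret finite_measure "lebesgue_on {0..2*pi}"
    by (rule finite_measure_lebesgue_on) simp
  define e where "e n t = cis (- (s * (real n * t)))" for n t
  have cnj_e: "cnj (e n t) = cis (s * (real n * t))" for n t
    by (simp add: e_def cis_cnj)
  have ec: "continuous_on A (e n)" for n A unfolding e_def by (intro continuous_intros)
  have em: "e n \<in> borel_measurable (lebesgue_on {0..2*pi})" for n
    by (intro continuous_imp_measurable_on_sets_lebesgue ec) simp
  have vm: "v \<in> borel_measurable (lebesgue_on {0..2*pi})"
    by (intro continuous_imp_measurable_on_sets_lebesgue vc) simp
  have en: "norm (e n t) \<le> 1" for n t by (simp add: e_def)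
  have orth: "(\<integral>t. e m t * cnj (e n t) \<partial>lebesgue_on {0..2*pi}) = (if m = n then of_real (2 * pi) else 0)" for m n
  proof -
    obtain \<sigma> :: int where \<sigma>: "s = of_int \<sigma>" "\<bar>\<sigma>\<bar> = 1"
      using s by (metis abs_1 abs_eq_iff of_int_1 of_int_minus abs_minus_cancel)
    have "(\<integral>t. e m t * cnj (e n t) \<partial>lebesgue_on {0..2*pi}) = integral {0..2*pi} (\<lambda>t. e m t * cnj (e n t))"
      by (intro integral_lebesgue_on_continuous continuous_intros ec)
    also have "\<dots> = integral {0..2*pi} (\<lambda>t. cis (of_int (\<sigma> * (int n - int m)) * t))"
      by (simp add: cnj_e) (simp add: e_def cis_mult \<sigma>(1) algebra_simps)
    also have "\<dots> = (if m = n then of_real (2 * pi) else 0)"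
      unfolding integral_cis_of_int using \<sigma>(2) by auto
    finally show ?thesis .
  qed
  have coeff: "(\<integral>t. v t * cnj (e n t) \<partial>lebesgue_on {0..2*pi}) = integral {0..2*pi} (\<lambda>t. v t * cis (s * (real n * t)))" for n
    by (subst integral_lebesgue_on_continuous) (auto intro!: continuous_intros ec vc simp: cnj_e)
  have vp: "(\<integral>t. norm (v t) powr p \<partial>lebesgue_on {0..2*pi}) = integral {0..2*pi} (\<lambda>t. norm (v t) powr p)"
    using p by (intro integral_lebesgue_on_continuous continuous_on_powr' continuous_intros vc) auto
  show "(\<Sum>n<N. real (Suc n) powr (p - 2) * norm (integral {0..2*pi} (\<lambda>t. v t * cis (s * (real n * t)))) powr p)
        \<le> C * integral {0..2*pi} (\<lambda>t. norm (v t) powr p)"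
  proof (cases "p = 2")
    case True
    have pw: "x powr p = x\<^sup>2" if "0 \<le> x" for x :: real using True that by simp
    have "(\<Sum>n<N. (norm (integral {0..2*pi} (\<lambda>t. v t * cis (s * (real n * t)))))\<^sup>2)
      \<le> 2 * pi * (\<integral>t. (norm (v t))\<^sup>2 \<partial>lebesgue_on {0..2*pi})"
      unfolding coeff[symmetric] by (rule Bessel_inequality[OF em vm en B orth]) simp
    then show ?thesis using True vp by (simp add: pw C_def)
  next
    case False
    then show ?thesis
      using Paley_inequality[OF em vm en B orth, of p N] p unfolding coeff vp by (simp add: C_def)
  qed
qed

text \<open>The sawtooth has purely imaginary coefficients proportional to \<open>1 / n\<close>,
  which is how the factor \<open>1 / n\<close> enters the sum for \<open>h^1\<close>. At
  \<open>n = 0\<close> both sides vanish, the right one because division by 0 gives 0.\<close>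

lemma integral_cis_mult_pi_minus:
  "integral {0..2*pi} (\<lambda>t. cis (real n * t) * of_real (pi - t)) = (2 * pi * \<i>) / of_nat n"
proof (cases "n = 0")
  case True
  define F :: "complex \<Rightarrow> complex" where "F z = of_real pi * z - z\<^sup>2 / 2" for z
  have "(F has_field_derivative (of_real pi - z)) (at z)" for z
    unfolding F_def by (auto intro!: derivative_eq_intros)
  from has_vector_derivative_real_field[OF this]
  have "((\<lambda>t. of_real pi - of_real t) has_integral F (of_real (2 * pi)) - F (of_real 0)) {0..2*pi}"
    by (intro fundamental_theorem_of_calculus[where f="\<lambda>t. F (of_real t)"]) (auto simp: o_def)
  then show ?thesis using True by (simp add: integral_unique F_def power2_eq_square)
next
  case False
  define F :: "complex \<Rightarrow> complex" where
    "F z = (of_real pi - z) * exp (\<i> * of_nat n * z) / (\<i> * of_nat n) + exp (\<i> * of_nat n * z) / (\<i> * of_nat n)\<^sup>2" for z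
  have "(F has_field_derivative exp (\<i> * of_nat n * z) * (of_real pi - z)) (at z)" for z
    unfolding F_def using False
    by (auto intro!: derivative_eq_intros simp: power2_eq_square field_simps)
  from has_vector_derivative_real_field[OF this]
  have "((\<lambda>t. exp (\<i> * of_nat n * of_real t) * (of_real pi - of_real t)) has_integral F (of_real (2 * pi)) - F (of_real 0)) {0..2*pi}"
    by (intro fundamental_theorem_of_calculus[where f="\<lambda>t. F (of_real t)"]) (auto simp: o_def)
  moreover have "exp (\<i> * of_nat n * of_real t) = cis (real n * t)" for t
    by (simp add: cis_conv_exp mult_ac)
  moreover have "F (of_real (2 * pi)) - F (of_real 0) = (2 * pi * \<i>) / of_nat n"
  proof -
    have "exp (\<i> * of_nat n * of_real (2 * pi)) = cis (2 * pi * real n)"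
      by (simp add: cis_conv_exp mult_ac)
    also have "\<dots> = 1" by (rule cis_multiple_2pi) simp
    finally show ?thesis using False by (simp add: F_def field_simps)
  qed
  ultimately show ?thesis by (simp add: integral_unique)
qed

text \<open>These coefficients are nonnegative; this is the reason for choosing a tent, since a
  series of nonnegative terms may be bounded below by any of its partial sums.\<close>

lemma integral_cos_mult_tent:
  fixes x :: real
  assumes "0 \<le> x" "x \<le> 2 * pi" and n: "n \<noteq> 0"
  shows "integral {0..2*pi} (\<lambda>t. cos (real n * t) * max (x - t) 0) = (1 - cos (real n * x)) / (real n)\<^sup>2"
proof -
  have "((\<lambda>t. cos (real n * t) * (x - t)) has_integral
     ((x - x) * sin (real n * x) / real n - cos (real n * x) / (real n)\<^sup>2)
     - ((x - 0) * sin (real n * 0) / real n - cos (real n * 0) / (real n)\<^sup>2)) {0..x}"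
    using assms
    by (intro fundamental_theorem_of_calculus[where f="\<lambda>t. (x - t) * sin (real n * t) / real n - cos (real n * t) / (real n)\<^sup>2"])
      (auto intro!: derivative_eq_intros simp: has_real_derivative_iff_has_vector_derivative[symmetric] power2_eq_square field_simps)
  then have "((\<lambda>t. cos (real n * t) * (x - t)) has_integral (1 - cos (real n * x)) / (real n)\<^sup>2) {0..x}"
    by (simp add: diff_divide_distrib)
  then have "((\<lambda>t. if t \<in> {0..x} then cos (real n * t) * (x - t) else 0) has_integral (1 - cos (real n * x)) / (real n)\<^sup>2) {0..2*pi}"
    using assms by (subst has_integral_restrict) auto
  moreover have "(if t \<in> {0..x} then cos (real n * t) * (x - t) else 0) = cos (real n * t) * max (x - t) 0"
    if "t \<in> {0..2*pi}" for t using that by auto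
  ultimately have "((\<lambda>t. cos (real n * t) * max (x - t) 0) has_integral (1 - cos (real n * x)) / (real n)\<^sup>2) {0..2*pi}"
    by (rule has_integral_eq[rotated])
  then show ?thesis by (rule integral_unique)
qed

lemma sin_ge_third:
  fixes y :: real
  assumes "0 \<le> y" "y \<le> 2"
  shows "y / 3 \<le> sin y"
proof -
  \<comment> \<open>On [0, 2] the cubic term is at most \<open>2 * y / 3\<close>, which leaves
    \<open>y / 3\<close>. The endpoint 2 is a rational number beyond \<open>pi / 2\<close>.\<close>
  have "y - y ^ 3 / 6 \<le> sin y"
  proof -
    define \<phi> where "\<phi> = (\<lambda>y::real. sin y - (y - y ^ 3 / 6))"
    have "\<phi> 0 \<le> \<phi> y"
    proof (rule DERIV_nonneg_imp_nondecreasing[OF assms(1)])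
      fix x :: real
      show "\<exists>d. (\<phi> has_real_derivative d) (at x) \<and> 0 \<le> d"
      proof (intro exI conjI)
        show "(\<phi> has_real_derivative (cos x - (1 - x\<^sup>2 / 2))) (at x)"
          unfolding \<phi>_def by (auto intro!: derivative_eq_intros simp: power2_eq_square)
        have "cos x = 1 - 2 * (sin (x / 2))\<^sup>2"
          using cos_double_sin[of "x / 2"] by simp
        moreover have "(sin (x / 2))\<^sup>2 \<le> (x / 2)\<^sup>2"
          using abs_sin_x_le_abs_x[of "x / 2"] by (simp only: abs_le_square_iff)
        ultimately show "0 \<le> cos x - (1 - x\<^sup>2 / 2)" by (simp add: power_divide)
      qed
    qed
    then show ?thesis by (simp add: \<phi>_def)
  qed
  moreover have "y ^ 3 / 6 \<le> y * 4 / 6"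
    using assms mult_left_mono[OF mult_mono[of y 2 y 2], of y] by (simp add: power3_eq_cube mult.assoc mult.commute)
  ultimately show ?thesis by simp
qed

text \<open>Twice the square of \<open>y / 6\<close>, by the half-angle formula; this is the origin
  of the constant 18.\<close>

lemma one_minus_cos_ge:
  fixes y :: real
  assumes "0 \<le> y" "y \<le> 1"
  shows "y\<^sup>2 / 18 \<le> 1 - cos y"
proof -
  have "cos y = 1 - 2 * (sin (y / 2))\<^sup>2" using cos_double_sin[of "y / 2"] by simp
  moreover have "(y / 2 / 3)\<^sup>2 \<le> (sin (y / 2))\<^sup>2"
    using assms by (intro power_mono sin_ge_third) auto
  ultimately show ?thesis by (simp add: power_divide)
qed

lemma decreasing_to_zero_Re:
  assumes "decreasing_to_zero a" "1 \<le> n"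
  shows "Im (a n) = 0" "0 \<le> Re (a n)" "norm (a n) = Re (a n)"
  using assms unfolding decreasing_to_zero_def
  by (auto simp: complex_is_Real_iff in_Reals_norm)

lemma decreasing_to_zero_mono:
  assumes "decreasing_to_zero a" "1 \<le> m" "m \<le> n"
  shows "Re (a n) \<le> Re (a m)"
  using assms(3) by (induction n rule: dec_induct)
    (use assms(1,2) in \<open>auto simp: decreasing_to_zero_def intro: order_trans\<close>)

text \<open>For \<open>q = p - 2\<close> either sign occurs; the maximum covers both.\<close>

lemma powr_Suc_le:
  fixes q :: real
  assumes "1 \<le> n"
  shows "real (Suc n) powr q \<le> max 1 (2 powr q) * real n powr q"
proof (cases "0 \<le> q")
  case True
  have "real (Suc n) powr q \<le> (2 * real n) powr q"
    using True assms by (intro powr_mono2) auto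
  also have "\<dots> = 2 powr q * real n powr q" by (simp add: powr_mult)
  also have "\<dots> \<le> max 1 (2 powr q) * real n powr q" by (intro mult_right_mono) auto
  finally show ?thesis .
next
  case False
  have "real (Suc n) powr q \<le> real n powr q"
    using False assms by (intro powr_mono2') auto
  also have "\<dots> \<le> max 1 (2 powr q) * real n powr q"
    using mult_right_mono[of 1 "max 1 (2 powr q)" "real n powr q"] by simp
  finally show ?thesis .
qed

subsection \<open>Harmonic functions given by two power series\<close>

locale harmonic_power_series =
  fixes f h g :: "complex \<Rightarrow> complex" and a b :: "nat \<Rightarrow> complex"
  assumes hol: "h holomorphic_on ball 0 1" "g holomorphic_on ball 0 1" and g0: "g 0 = 0"
    and f_eq: "\<And>z. z \<in> ball 0 1 \<Longrightarrow> f z = h z + cnj (g z)"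
    and h_sums: "\<And>z. z \<in> ball 0 1 \<Longrightarrow> (\<lambda>n. a n * z ^ n) sums h z"
    and g_sums: "\<And>z. z \<in> ball 0 1 \<Longrightarrow> (\<lambda>n. b n * z ^ n) sums g z"
begin

lemma cont_h: "continuous_on (ball 0 1) h" and cont_g: "continuous_on (ball 0 1) g"
  using hol by (auto intro: holomorphic_on_imp_continuous_on)

lemma cont_f: "continuous_on (ball 0 1) f"
proof (rule continuous_on_eq)
  show "continuous_on (ball 0 1) (\<lambda>z. h z + cnj (g z))"
    by (intro continuous_intros cont_h cont_g)
qed (simp add: f_eq)

lemma b0: "b 0 = 0"
proof -
  have "(\<lambda>n. b n * 0 ^ n) sums g 0" by (rule g_sums) simp
  moreover have "(\<lambda>n. b n * 0 ^ n) sums b 0" by (rule powser_sums_zero)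
  ultimately show ?thesis using g0 sums_unique2 by metis
qed

lemma f_circle:
  assumes "0 \<le> r" "r < 1"
  shows "f (of_real r * cis t) = h (of_real r * cis t) + cnj (g (of_real r * cis t))"
  using assms by (intro f_eq) (simp add: norm_mult)

lemma coefficient_integrals:
  assumes "0 \<le> r" "r < 1"
  shows "2 * pi * (norm (a n) * r ^ n) = norm (integral {0..2*pi} (\<lambda>t. f (of_real r * cis t) * cis (- (real n * t))))"
    and "2 * pi * (norm (b n) * r ^ n) \<le> norm (integral {0..2*pi} (\<lambda>t. f (of_real r * cis t) * cis (real n * t)))"
  using harmonic_circle_coefficients[OF h_sums g_sums cont_h cont_g b0 assms, of n]
  unfolding f_circle[OF assms] by simp_all

lemma bounded_circle:
  assumes "0 \<le> r" "r < 1"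
  shows "bounded (range (\<lambda>t. f (of_real r * cis t)))"
proof -
  have "bounded (f ` sphere 0 r)"
    using assms by (intro compact_imp_bounded compact_continuous_image continuous_on_subset[OF cont_f]) auto
  then show ?thesis
    by (rule bounded_subset) (use assms in \<open>auto simp: norm_mult\<close>)
qed

lemma summable_coefficients_hp:
  assumes p: "1 < p" "p \<le> 2" and f: "f \<in> harmonic_hardy p"
  shows "summable (\<lambda>n. real (n + 1) powr (p - 2) * (norm (a n) powr p + norm (b n) powr p))"
proof -
  obtain C where C: "0 \<le> C" and HL:
    "\<And>v s N. \<lbrakk>continuous_on UNIV v; bounded (range v); \<bar>s\<bar> = 1\<rbrakk> \<Longrightarrow>
      (\<Sum>n<N. real (Suc n) powr (p - 2) * norm (integral {0..2*pi} (\<lambda>t. v t * cis (s * (real n * t)))) powr p)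
        \<le> C * integral {0..2*pi} (\<lambda>t. norm (v t) powr p)"
    by (rule Hardy_Littlewood_Fourier_coefficients[OF p]) (rule that)
  obtain B r0 where r0: "0 \<le> r0" "r0 < 1" and B:
    "\<And>r. \<lbrakk>r0 < r; r < 1\<rbrakk> \<Longrightarrow> integral {0..2*pi} (\<lambda>t. norm (f (of_real r * cis t)) powr p) \<le> B"
    by (rule harmonic_hardy_integral_bound[OF f cont_f]) (use p in simp, rule that)
  \<comment> \<open>Stated for a general sequence \<open>c\<close> and sign \<open>s\<close>, to be
    used with \<open>s = -1\<close> for \<open>a\<close> and \<open>s = 1\<close> for
    \<open>b\<close>. The constants \<open>C\<close> and \<open>B\<close> do not depend on the
    radius.\<close>
  have main: "summable (\<lambda>n. real (Suc n) powr (p - 2) * norm (c n) powr p)"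
    if s: "\<bar>s\<bar> = 1" and c: "\<And>r n. \<lbrakk>0 \<le> r; r < 1\<rbrakk> \<Longrightarrow> 2 * pi * (norm (c n) * r ^ n)
       \<le> norm (integral {0..2*pi} (\<lambda>t. f (of_real r * cis t) * cis (s * (real n * t))))" for c :: "nat \<Rightarrow> complex" and s
  proof (rule summable_of_bounded_dilations[OF _ _ _ r0(2)])
    fix r N assume r: "r0 < r" "r < 1"
    then have r': "0 \<le> r" using r0 by simp
    have "norm (c n) * r ^ n \<le> norm (integral {0..2*pi} (\<lambda>t. f (of_real r * cis t) * cis (s * (real n * t))))" for n
    proof -
      have "1 * (norm (c n) * r ^ n) \<le> 2 * pi * (norm (c n) * r ^ n)"
        using pi_gt3 r' by (intro mult_right_mono) auto
      also note c[OF r' r(2), of n]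
      finally show ?thesis by simp
    qed
    then have "(\<Sum>n<N. real (Suc n) powr (p - 2) * (norm (c n) * r ^ n) powr p)
      \<le> (\<Sum>n<N. real (Suc n) powr (p - 2) * norm (integral {0..2*pi} (\<lambda>t. f (of_real r * cis t) * cis (s * (real n * t)))) powr p)"
      using p r' by (intro sum_mono mult_left_mono powr_mono2) auto
    also have "\<dots> \<le> C * integral {0..2*pi} (\<lambda>t. norm (f (of_real r * cis t)) powr p)"
      by (intro HL continuous_on_circle[OF cont_f r' r(2)] bounded_circle[OF r' r(2)] s)
    also have "\<dots> \<le> C * B"
      by (intro mult_left_mono B r C)
    finally show "(\<Sum>n<N. real (Suc n) powr (p - 2) * (norm (c n) * r ^ n) powr p) \<le> C * B" .
  qed (use p in auto)
  have "summable (\<lambda>n. real (Suc n) powr (p - 2) * norm (a n) powr p)"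
    by (rule main[of "-1"]) (use coefficient_integrals(1) in auto)
  moreover have "summable (\<lambda>n. real (Suc n) powr (p - 2) * norm (b n) powr p)"
    by (rule main[of 1]) (use coefficient_integrals(2) in auto)
  ultimately show ?thesis
    by (simp add: distrib_left summable_add)
qed

lemma summable_coefficients_h1:
  assumes f: "f \<in> harmonic_hardy 1" and p: "0 < p" "p < 1"
  shows "summable (\<lambda>n. real (n + 1) powr (p - 2) * (norm (a n) powr p + norm (b n) powr p))"
proof -
  obtain B r0 where r0: "0 \<le> r0" "r0 < 1" and B:
    "\<And>r. \<lbrakk>r0 < r; r < 1\<rbrakk> \<Longrightarrow> integral {0..2*pi} (\<lambda>t. norm (f (of_real r * cis t)) powr 1) \<le> B"
    by (rule harmonic_hardy_integral_bound[OF f cont_f]) (simp, rule that)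
  \<comment> \<open>Here \<open>p < 1\<close> is decisive: the exponent is below -1, so bounded
    coefficients are enough.\<close>
  have "summable (\<lambda>n. real n powr (p - 2))" using p by (simp add: summable_real_powr_iff)
  then have sm: "summable (\<lambda>n. real (Suc n) powr (p - 2) * B powr p)"
    by (intro summable_mult2) (subst summable_Suc_iff)
  have main: "summable (\<lambda>n. real (Suc n) powr (p - 2) * norm (c n) powr p)"
    if c: "\<And>r n. \<lbrakk>0 \<le> r; r < 1\<rbrakk> \<Longrightarrow> 2 * pi * (norm (c n) * r ^ n)
       \<le> norm (integral {0..2*pi} (\<lambda>t. f (of_real r * cis t) * cis (s * (real n * t))))" for c :: "nat \<Rightarrow> complex" and s
  proof (rule summable_of_bounded_dilations[OF _ _ _ r0(2)])
    fix r N assume r: "r0 < r" "r < 1"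
    then have r': "0 \<le> r" using r0 by simp
    have "norm (c n) * r ^ n \<le> B" for n
    proof -
      have "1 * (norm (c n) * r ^ n) \<le> 2 * pi * (norm (c n) * r ^ n)"
        using pi_gt3 r' by (intro mult_right_mono) auto
      also note c[OF r' r(2), of n]
      also have "norm (integral {0..2*pi} (\<lambda>t. f (of_real r * cis t) * cis (s * (real n * t))))
          \<le> integral {0..2*pi} (\<lambda>t. norm (f (of_real r * cis t)) powr 1)"
        by (intro integral_norm_bound_integral integrable_continuous_interval continuous_intros
            continuous_on_circle[OF cont_f r' r(2)] continuous_on_powr') (auto simp: norm_mult)
      also have "\<dots> \<le> B" by (rule B[OF r])
      finally show ?thesis by simp
    qed
    then have "(\<Sum>n<N. real (Suc n) powr (p - 2) * (norm (c n) * r ^ n) powr p) \<le> (\<Sum>n<N. real (Suc n) powr (p - 2) * B powr p)"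
      using p r' by (intro sum_mono mult_left_mono powr_mono2) auto
    also have "\<dots> \<le> (\<Sum>n. real (Suc n) powr (p - 2) * B powr p)"
      by (intro sum_le_suminf sm) auto
    finally show "(\<Sum>n<N. real (Suc n) powr (p - 2) * (norm (c n) * r ^ n) powr p)
      \<le> (\<Sum>n. real (Suc n) powr (p - 2) * B powr p)" .
  qed (use p in auto)
  have "summable (\<lambda>n. real (Suc n) powr (p - 2) * norm (a n) powr p)"
    by (rule main[of _ "-1"]) (use coefficient_integrals(1) in auto)
  moreover have "summable (\<lambda>n. real (Suc n) powr (p - 2) * norm (b n) powr p)"
    by (rule main[of _ 1]) (use coefficient_integrals(2) in auto)
  ultimately show ?thesis
    by (simp add: distrib_left summable_add)
qed

end

section \<open>Pairing with test functions when the coefficients decrease\<close>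

context harmonic_power_series
begin

lemma hg_sums:
  assumes "z \<in> ball 0 1"
  shows "(\<lambda>n. (a n + b n) * z ^ n) sums (h z + g z)"
  using sums_add[OF h_sums g_sums] assms by (simp add: distrib_right)

lemma summable_coefficients_Im_nonzero:
  assumes Im: "\<And>z. z \<in> ball 0 1 \<Longrightarrow> Im (h z) \<noteq> 0"
    and dec: "decreasing_to_zero a" "decreasing_to_zero b" and f: "f \<in> harmonic_hardy 1"
  shows "summable (\<lambda>n. norm (a n + b n) / real (n + 1))"
proof -
  obtain B r0 where r0: "0 \<le> r0" "r0 < 1" and B:
    "\<And>r. \<lbrakk>r0 < r; r < 1\<rbrakk> \<Longrightarrow> integral {0..2*pi} (\<lambda>t. norm (f (of_real r * cis t)) powr 1) \<le> B"
    by (rule harmonic_hardy_integral_bound[OF f cont_f]) (simp, rule that)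
  have conn: "connected ((\<lambda>z. Im (h z)) ` ball 0 1)"
    by (intro connected_continuous_image continuous_intros cont_h) simp
  \<comment> \<open>The image of the disc under Im h is connected, hence an interval, and it omits
    0.\<close>
  have sign: "(\<forall>z\<in>ball 0 1. 0 < Im (h z)) \<or> (\<forall>z\<in>ball 0 1. Im (h z) < 0)"
  proof (rule ccontr)
    assume "\<not> ?thesis"
    then obtain z w where zw: "z \<in> ball 0 1" "w \<in> ball 0 1" "Im (h z) \<le> 0" "0 \<le> Im (h w)"
      by (force simp: not_less)
    then have "0 \<in> (\<lambda>z. Im (h z)) ` ball 0 1"
      using connectedD_interval[OF conn, of "Im (h z)" "Im (h w)" 0] by blast
    then show False using Im by auto
  qed
  have ab: "a n + b n = of_real (Re (a n + b n))" "norm (a n + b n) = Re (a n + b n)" "0 \<le> Re (a n + b n)" if "1 \<le> n" for n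
  proof -
    show 1: "a n + b n = of_real (Re (a n + b n))" and 2: "0 \<le> Re (a n + b n)"
      using decreasing_to_zero_Re[OF dec(1) that] decreasing_to_zero_Re[OF dec(2) that]
      by (simp_all add: complex_eq_iff)
    show "norm (a n + b n) = Re (a n + b n)"
      by (metis 1 2 abs_of_nonneg norm_of_real)
  qed
  \<comment> \<open>The term of index 0 is 0 because \<open>1 / real 0 = 0\<close>, so the
    unconstrained \<open>a 0\<close> does not enter this series.\<close>
  have "summable (\<lambda>n. 1 / real n * norm (a n + b n) powr 1)"
  proof (rule summable_of_bounded_dilations[OF _ _ _ r0(2)])
    fix r N assume r: "r0 < r" "r < 1"
    then have r': "0 \<le> r" using r0 by simp
    let ?z = "\<lambda>t. of_real r * cis t"
    have zin: "?z t \<in> ball 0 1" for t using r r' by (simp add: norm_mult)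
    note ch = continuous_on_circle[OF cont_h r' r(2)] and cg = continuous_on_circle[OF cont_g r' r(2)]
      and cf = continuous_on_circle[OF cont_f r' r(2)]
    define J where "J = integral {0..2*pi} (\<lambda>t. (h (?z t) + g (?z t)) * of_real (pi - t))"
    have "(\<lambda>n. (a n + b n) * of_real r ^ n * integral {0..2*pi} (\<lambda>t. cis (real n * t) * of_real (pi - t))) sums J"
      unfolding J_def by (rule powser_circle_pairing_sums[OF hg_sums r' r(2)]) (auto intro!: continuous_intros)
    then have "(\<lambda>n. Im ((a n + b n) * of_real r ^ n * ((2 * pi * \<i>) / of_nat n))) sums Im J"
      unfolding integral_cis_mult_pi_minus by (rule sums_Im)
    moreover have tm: "Im ((a n + b n) * of_real r ^ n * ((2 * pi * \<i>) / of_nat n)) = 2 * pi * (1 / real n * (norm (a n + b n) * r ^ n) powr 1)" for n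
    proof (cases "n = 0")
      case False
      then have n: "1 \<le> n" by simp
      have "(a n + b n) * of_real r ^ n * ((2 * pi * \<i>) / of_nat n) = of_real (Re (a n + b n) * r ^ n * (2 * pi / real n)) * \<i>"
        by (subst ab(1)[OF n]) simp
      also have "Im \<dots> = Re (a n + b n) * r ^ n * (2 * pi / real n)" by simp
      finally show ?thesis using ab[OF n] r' by simp
    qed simp
    ultimately have S: "(\<lambda>n. 2 * pi * (1 / real n * (norm (a n + b n) * r ^ n) powr 1)) sums Im J"
      by (simp only:)
    have "2 * pi * (\<Sum>n<N. 1 / real n * (norm (a n + b n) * r ^ n) powr 1) \<le> Im J"
      unfolding sum_distrib_left by (rule sum_le_sums_nonneg[OF S]) (use r' in auto)
    also have "Im J = integral {0..2*pi} (\<lambda>t. Im ((h (?z t) + g (?z t)) * of_real (pi - t)))"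
      unfolding J_def
      by (intro Im_integral integrable_continuous_interval continuous_intros ch cg)
    also have "\<dots> \<le> integral {0..2*pi} (\<lambda>t. pi * (2 * \<bar>Im (h (?z t))\<bar> + norm (f (?z t)) powr 1))"
    proof (rule integral_le)
      show "(\<lambda>t. Im ((h (?z t) + g (?z t)) * of_real (pi - t))) integrable_on {0..2*pi}"
        by (intro integrable_continuous_interval continuous_intros ch cg)
      show "(\<lambda>t. pi * (2 * \<bar>Im (h (?z t))\<bar> + norm (f (?z t)) powr 1)) integrable_on {0..2*pi}"
        by (intro integrable_continuous_interval continuous_intros continuous_on_powr' ch cf) auto
      fix t assume t: "t \<in> {0..2*pi}"
      have "Im (f (?z t)) = Im (h (?z t)) - Im (g (?z t))"
        using f_circle[OF r' r(2), of t] by simp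
      then have "Im ((h (?z t) + g (?z t)) * of_real (pi - t)) = (2 * Im (h (?z t)) - Im (f (?z t))) * (pi - t)"
        by simp
      also have "\<dots> \<le> \<bar>2 * Im (h (?z t)) - Im (f (?z t))\<bar> * \<bar>pi - t\<bar>"
        by (metis abs_ge_self abs_mult)
      also have "\<dots> \<le> (2 * \<bar>Im (h (?z t))\<bar> + norm (f (?z t))) * pi"
        using t abs_Im_le_cmod[of "f (?z t)"] by (intro mult_mono) auto
      finally show "Im ((h (?z t) + g (?z t)) * of_real (pi - t)) \<le> pi * (2 * \<bar>Im (h (?z t))\<bar> + norm (f (?z t)) powr 1)"
        by (simp add: mult.commute)
    qed
    also have "\<dots> = pi * (2 * integral {0..2*pi} (\<lambda>t. \<bar>Im (h (?z t))\<bar>) + integral {0..2*pi} (\<lambda>t. norm (f (?z t)) powr 1))"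
    proof -
      have i: "(\<lambda>t. \<bar>Im (h (?z t))\<bar>) integrable_on {0..2*pi}"
        by (intro integrable_continuous_interval continuous_intros ch)
      have j: "(\<lambda>t. norm (f (?z t)) powr 1) integrable_on {0..2*pi}"
        by (intro integrable_continuous_interval continuous_intros continuous_on_powr' cf) auto
      show ?thesis
        by (simp only: integral_mult_right Henstock_Kurzweil_Integration.integral_add[OF integrable_on_mult_right[OF i] j])
    qed
    \<comment> \<open>With a constant sign the absolute value moves outside the integral, and the
      mean value property gives a number independent of \<open>r\<close>.\<close>
    also have "integral {0..2*pi} (\<lambda>t. \<bar>Im (h (?z t))\<bar>) = 2 * pi * \<bar>Im (a 0)\<bar>"
    proof -
      have "integral {0..2*pi} (\<lambda>t. Im (h (?z t))) = Im (integral {0..2*pi} (\<lambda>t. h (?z t)))"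
        by (intro Im_integral[symmetric] integrable_continuous_interval ch)
      also have "integral {0..2*pi} (\<lambda>t. h (?z t)) = 2 * pi * a 0"
        using powser_circle_coefficient[OF h_sums r' r(2), of 0] by simp
      finally have *: "integral {0..2*pi} (\<lambda>t. Im (h (?z t))) = 2 * pi * Im (a 0)" by simp
      from sign show ?thesis
      proof
        assume pos: "\<forall>z\<in>ball 0 1. 0 < Im (h z)"
        have "0 \<le> integral {0..2*pi} (\<lambda>t. Im (h (?z t)))"
          using pos zin by (intro integral_nonneg integrable_continuous_interval continuous_intros ch) (auto intro: less_imp_le)
        moreover have "\<bar>Im (h (?z t))\<bar> = Im (h (?z t))" for t
          using pos zin by (simp add: abs_of_pos)
        ultimately show ?thesis using * pi_gt_zero by (auto simp: zero_le_mult_iff)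
      next
        assume neg: "\<forall>z\<in>ball 0 1. Im (h z) < 0"
        have abs: "\<bar>Im (h (?z t))\<bar> = - Im (h (?z t))" for t
          using neg zin by (simp add: abs_of_neg)
        have "0 \<le> integral {0..2*pi} (\<lambda>t. - Im (h (?z t)))"
          using neg zin by (intro integral_nonneg integrable_continuous_interval continuous_intros ch) (auto intro: less_imp_le)
        with * have "2 * pi * Im (a 0) \<le> 0" by simp
        then have "Im (a 0) \<le> 0" using mult_le_0_iff[of "2 * pi" "Im (a 0)"] pi_gt_zero by (smt (verit))
        with * show ?thesis unfolding abs by simp
      qed
    qed
    finally have "2 * pi * (\<Sum>n<N. 1 / real n * (norm (a n + b n) * r ^ n) powr 1)
        \<le> pi * (2 * (2 * pi * \<bar>Im (a 0)\<bar>) + integral {0..2*pi} (\<lambda>t. norm (f (?z t)) powr 1))" .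
    also have "\<dots> \<le> pi * (2 * (2 * pi * \<bar>Im (a 0)\<bar>) + B)"
      using B[OF r] by (intro mult_left_mono add_left_mono) auto
    finally have "2 * (\<Sum>n<N. 1 / real n * (norm (a n + b n) * r ^ n) powr 1) \<le> 2 * (2 * pi * \<bar>Im (a 0)\<bar>) + B"
      by (simp only: mult_ac mult_le_cancel_left_pos[OF pi_gt_zero])
    then show "(\<Sum>n<N. 1 / real n * (norm (a n + b n) * r ^ n) powr 1) \<le> (2 * (2 * pi * \<bar>Im (a 0)\<bar>) + B) / 2"
      by simp
  qed auto
  then show ?thesis
  proof (rule summable_comparison_test'[where N=1])
    fix n :: nat assume "1 \<le> n"
    then show "norm (norm (a n + b n) / real (n + 1)) \<le> 1 / real n * norm (a n + b n) powr 1"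
      by (simp add: divide_left_mono)
  qed
qed

text \<open>Pairing with the tent gives a series of nonnegative terms. Each of the terms 1 to
  \<open>n\<close> is at least \<open>Re (c n) * r ^ n * x^2 / 18\<close>, and with
  \<open>n * x = 1\<close> they add up to at least \<open>x * Re (c n) * r ^ n / 18\<close>. The
  tent is at most \<open>x\<close>, so the pairing is at most \<open>x\<close> times the integral;
  \<open>x\<close> cancels.\<close>

lemma coefficient_le_integral:
  assumes dec: "decreasing_to_zero a" "decreasing_to_zero b" and r: "0 \<le> r" "r < 1" and n: "1 \<le> n"
  shows "norm (a n + b n) * r ^ n
    \<le> 18 * integral {0..1 / real n} (\<lambda>t. norm (f (of_real r * cis t)) + norm (a 0))"
proof -
  let ?z = "\<lambda>t. of_real r * cis t"
  let ?w = "\<lambda>t. norm (f (?z t)) + norm (a 0)"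
  define x where "x = 1 / real n"
  have x: "0 < x" "x \<le> 1" "real n * x = 1" using n by (auto simp: x_def)
  have x2: "x \<le> 2 * pi" using x pi_gt3 by linarith
  note ch = continuous_on_circle[OF cont_h r] and cg = continuous_on_circle[OF cont_g r]
    and cf = continuous_on_circle[OF cont_f r]
  \<comment> \<open>The constant term has no sign and is removed; subtracting \<open>a 0\<close>
    from the function costs the summand \<open>norm (a 0)\<close> in \<open>?w\<close>.\<close>
  define c where "c n = (if n = 0 then 0 else a n + b n)" for n
  define H where "H z = h z + g z - a 0" for z
  have c_real: "c k = of_real (Re (c k))" and c_nonneg: "0 \<le> Re (c k)" for k
    using decreasing_to_zero_Re[OF dec(1), of k] decreasing_to_zero_Re[OF dec(2), of k]
    by (auto simp: c_def complex_eq_iff)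
  have c_mono: "Re (c n) \<le> Re (c k)" if "1 \<le> k" "k \<le> n" for k
    using decreasing_to_zero_mono[OF dec(1) that] decreasing_to_zero_mono[OF dec(2) that] that n
    by (simp add: c_def)
  have H_sums: "(\<lambda>n. c n * z ^ n) sums H z" if "z \<in> ball 0 1" for z
  proof -
    have "(\<lambda>n. if n = 0 then a n * z ^ n else 0) sums (a 0 * z ^ 0)" by (rule sums_single)
    from sums_diff[OF hg_sums[OF that] this]
    have "(\<lambda>n. (a n + b n) * z ^ n - (if n = 0 then a n * z ^ n else 0)) sums H z"
      by (simp add: H_def)
    moreover have "(a n + b n) * z ^ n - (if n = 0 then a n * z ^ n else 0) = c n * z ^ n" for n
      by (simp add: c_def b0)
    ultimately show ?thesis by simp
  qed
  define \<phi> where "\<phi> t = max (x - t) 0" for t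
  have \<phi>c: "continuous_on A \<phi>" for A unfolding \<phi>_def by (intro continuous_intros)
  define J where "J = integral {0..2*pi} (\<lambda>t. H (?z t) * of_real (\<phi> t))"
  define \<rho> where "\<rho> k = (if k = 0 then 0 else Re (c k) * r ^ k * ((1 - cos (real k * x)) / (real k)\<^sup>2))" for k
  have "(\<lambda>n. c n * of_real r ^ n * integral {0..2*pi} (\<lambda>t. cis (real n * t) * of_real (\<phi> t))) sums J"
    unfolding J_def by (intro powser_circle_pairing_sums[OF H_sums r] continuous_on_of_real \<phi>c)
  then have "(\<lambda>n. Re (c n * of_real r ^ n * integral {0..2*pi} (\<lambda>t. cis (real n * t) * of_real (\<phi> t)))) sums Re J"
    by (rule sums_Re)
  moreover have "Re (c k * of_real r ^ k * integral {0..2*pi} (\<lambda>t. cis (real k * t) * of_real (\<phi> t))) = \<rho> k" for k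
  proof (cases "k = 0")
    case True
    then show ?thesis by (simp add: \<rho>_def c_def)
  next
    case False
    have "Re (c k * of_real r ^ k * integral {0..2*pi} (\<lambda>t. cis (real k * t) * of_real (\<phi> t)))
      = Re (c k) * r ^ k * Re (integral {0..2*pi} (\<lambda>t. cis (real k * t) * of_real (\<phi> t)))"
    proof -
      have "Re (of_real u * of_real r ^ k * w) = u * r ^ k * Re w" for u w
        by (simp flip: of_real_power of_real_mult)
      then show ?thesis using c_real by metis
    qed
    also have "Re (integral {0..2*pi} (\<lambda>t. cis (real k * t) * of_real (\<phi> t)))
      = integral {0..2*pi} (\<lambda>t. Re (cis (real k * t) * of_real (\<phi> t)))"
      by (intro Re_integral integrable_continuous_interval continuous_intros \<phi>c)
    also have "\<dots> = (1 - cos (real k * x)) / (real k)\<^sup>2"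
      using integral_cos_mult_tent[of x k] x x2 False by (simp add: \<phi>_def)
    finally show ?thesis using False by (simp add: \<rho>_def)
  qed
  ultimately have S: "\<rho> sums Re J" by simp
  have \<rho>0: "0 \<le> \<rho> k" for k
    using c_nonneg r by (simp add: \<rho>_def)
  have "real n * (Re (c n) * r ^ n * (x\<^sup>2 / 18)) = (\<Sum>k\<in>{1..n}. Re (c n) * r ^ n * (x\<^sup>2 / 18))"
    by simp
  also have "\<dots> \<le> (\<Sum>k\<in>{1..n}. \<rho> k)"
  proof (rule sum_mono)
    fix k assume k: "k \<in> {1..n}"
    \<comment> \<open>This keeps the argument of the cosine in the range of the quadratic lower
      bound, and it is why exactly \<open>n\<close> terms are used.\<close>
    have "real k * x \<le> 1" using k x(1) mult_right_mono[of "real k" "real n" x] x(3) by simp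
    then have "(real k * x)\<^sup>2 / 18 \<le> 1 - cos (real k * x)"
      using x by (intro one_minus_cos_ge) auto
    then have "x\<^sup>2 / 18 \<le> (1 - cos (real k * x)) / (real k)\<^sup>2"
      using k by (simp add: field_simps power_mult_distrib)
    moreover have "r ^ n \<le> r ^ k" using r k by (intro power_decreasing) auto
    ultimately have "Re (c n) * r ^ n * (x\<^sup>2 / 18) \<le> Re (c k) * r ^ k * ((1 - cos (real k * x)) / (real k)\<^sup>2)"
      using c_mono[of k] k c_nonneg r by (intro mult_mono) auto
    then show "Re (c n) * r ^ n * (x\<^sup>2 / 18) \<le> \<rho> k" using k by (simp add: \<rho>_def)
  qed
  also have "\<dots> \<le> Re J"
    by (rule sum_le_sums_nonneg[OF S]) (use \<rho>0 in auto)
  also have "Re J = integral {0..2*pi} (\<lambda>t. Re (H (?z t) * of_real (\<phi> t)))"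
    unfolding J_def H_def by (intro Re_integral integrable_continuous_interval continuous_intros \<phi>c ch cg)
  also have "\<dots> \<le> integral {0..2*pi} (\<lambda>t. if t \<in> {0..x} then x * ?w t else 0)"
  proof (rule integral_le)
    show "(\<lambda>t. Re (H (?z t) * of_real (\<phi> t))) integrable_on {0..2*pi}"
      unfolding H_def by (intro integrable_continuous_interval continuous_intros \<phi>c ch cg)
    have sub: "{0..x} \<subseteq> {0..2*pi}" using x2 by auto
    show "(\<lambda>t. if t \<in> {0..x} then x * ?w t else 0) integrable_on {0..2*pi}"
      by (subst integrable_restrict_Int, subst Int_absorb2[OF sub])
        (intro integrable_continuous_interval continuous_intros cf)
    fix t assume t: "t \<in> {0..2*pi}"
    have "Re (H (?z t)) = Re (f (?z t)) - Re (a 0)"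
      using f_circle[OF r, of t] by (simp add: H_def)
    also have "\<dots> \<le> ?w t"
      using abs_Re_le_cmod[of "f (?z t)"] abs_Re_le_cmod[of "a 0"] by linarith
    finally have "Re (H (?z t)) \<le> ?w t" .
    then have "Re (H (?z t)) * \<phi> t \<le> ?w t * \<phi> t"
      by (rule mult_right_mono) (simp add: \<phi>_def)
    also have "\<dots> \<le> (if t \<in> {0..x} then x * ?w t else 0)"
    proof (cases "t \<le> x")
      case True
      then show ?thesis using t mult_right_mono[of "x - t" x "?w t"] by (simp add: \<phi>_def mult.commute)
    next
      case False
      then show ?thesis by (simp add: \<phi>_def)
    qed
    finally show "Re (H (?z t) * of_real (\<phi> t)) \<le> (if t \<in> {0..x} then x * ?w t else 0)"
      by simp
  qed
  also have "\<dots> = integral {0..x} (\<lambda>t. x * ?w t)"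
    using x2 by (subst integral_restrict_Int) (auto simp: Int_absorb2)
  also have "\<dots> = x * integral {0..x} ?w" by simp
  finally have "real n * (Re (c n) * r ^ n * (x\<^sup>2 / 18)) \<le> x * integral {0..x} ?w" .
  moreover have "real n * (Re (c n) * r ^ n * (x\<^sup>2 / 18)) = (real n * x) * (x * (Re (c n) * r ^ n) / 18)"
    by (simp add: power2_eq_square)
  ultimately have "x * (Re (c n) * r ^ n) / 18 \<le> x * integral {0..x} ?w"
    by (simp only: x(3) mult_1)
  then have "x * (Re (c n) * r ^ n) \<le> x * (18 * integral {0..x} ?w)"
    by simp
  then have "Re (c n) * r ^ n \<le> 18 * integral {0..x} ?w"
    using x by (simp only: mult_le_cancel_left_pos)
  moreover have "norm (a n + b n) = Re (c n)"
  proof -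
    have "norm (c n) = Re (c n)" by (metis c_real c_nonneg abs_of_nonneg norm_of_real)
    then show ?thesis using n by (simp add: c_def)
  qed
  ultimately show ?thesis by (simp add: x_def)
qed

lemma summable_coefficients_decreasing:
  assumes dec: "decreasing_to_zero a" "decreasing_to_zero b" and p: "1 < p" and f: "f \<in> harmonic_hardy p"
  shows "summable (\<lambda>n. real (n + 1) powr (p - 2) * (norm (a n) powr p + norm (b n) powr p))"
proof -
  obtain B r0 where r0: "0 \<le> r0" "r0 < 1" and B:
    "\<And>r. \<lbrakk>r0 < r; r < 1\<rbrakk> \<Longrightarrow> integral {0..2*pi} (\<lambda>t. norm (f (of_real r * cis t)) powr p) \<le> B"
    by (rule harmonic_hardy_integral_bound[OF f cont_f]) (use p in simp, rule that)
  obtain C where C: "0 \<le> C" and Hardy: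
    "\<And>w N. \<lbrakk>continuous_on {0..1} w; \<forall>t\<in>{0..1}. 0 \<le> w t\<rbrakk> \<Longrightarrow>
      (\<Sum>n<N. real (Suc n) powr (p - 2) * (integral {0..1 / real (Suc n)} w) powr p)
        \<le> C * integral {0..1} (\<lambda>t. w t powr p)"
    by (rule Hardy_inequality_shrinking_intervals[OF p]) (rule that)
  define K where "K = 18 powr p * (C * (2 powr p * (B + 2 * pi * norm (a 0) powr p)))"
  \<comment> \<open>The weight is \<open>real n\<close>, not \<open>real (n + 1)\<close>: index
    \<open>Suc n\<close> then matches the interval of length \<open>1 / Suc n\<close> in Hardy's
    inequality, and index 0 drops out because \<open>0 powr y = 0\<close>.\<close>
  have S: "summable (\<lambda>n. real n powr (p - 2) * norm (a n + b n) powr p)"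
  proof (rule summable_of_bounded_dilations[OF _ _ _ r0(2)])
    fix r N assume r: "r0 < r" "r < 1"
    then have r': "0 \<le> r" using r0 by simp
    note cf = continuous_on_circle[OF cont_f r' r(2)]
    let ?w = "\<lambda>t. norm (f (of_real r * cis t)) + norm (a 0)"
    have wc: "continuous_on A (\<lambda>t. ?w t powr p)" for A
      by (intro continuous_on_powr' continuous_intros cf) (use p in auto)
    have fc: "continuous_on A (\<lambda>t. norm (f (of_real r * cis t)) powr p)" for A
      by (intro continuous_on_powr' continuous_intros cf) (use p in auto)
    have "(\<Sum>n<N. real n powr (p - 2) * (norm (a n + b n) * r ^ n) powr p)
      \<le> (\<Sum>n<Suc N. real n powr (p - 2) * (norm (a n + b n) * r ^ n) powr p)" by simp
    also have "\<dots> = (\<Sum>n<N. real (Suc n) powr (p - 2) * (norm (a (Suc n) + b (Suc n)) * r ^ Suc n) powr p)"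
      by (subst sum.lessThan_Suc_shift) simp
    also have "\<dots> \<le> (\<Sum>n<N. real (Suc n) powr (p - 2) * (18 * integral {0..1 / real (Suc n)} ?w) powr p)"
      using r' p by (intro sum_mono mult_left_mono powr_mono2 coefficient_le_integral dec r) auto
    also have "\<dots> = 18 powr p * (\<Sum>n<N. real (Suc n) powr (p - 2) * (integral {0..1 / real (Suc n)} ?w) powr p)"
    proof -
      have "0 \<le> integral {0..1 / real (Suc n)} ?w" for n
        by (intro integral_nonneg integrable_continuous_interval continuous_intros cf) auto
      then show ?thesis
        unfolding sum_distrib_left by (intro sum.cong refl) (simp add: powr_mult)
    qed
    also have "\<dots> \<le> 18 powr p * (C * integral {0..1} (\<lambda>t. ?w t powr p))"
      by (intro mult_left_mono Hardy continuous_intros cf) auto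
    also have "\<dots> \<le> 18 powr p * (C * integral {0..2*pi} (\<lambda>t. ?w t powr p))"
      using pi_gt3 C
      by (intro mult_left_mono integral_subset_le integrable_continuous_interval wc) auto
    also have "\<dots> \<le> 18 powr p * (C * integral {0..2*pi} (\<lambda>t. 2 powr p * (norm (f (of_real r * cis t)) powr p + norm (a 0) powr p)))"
      using C p
      by (intro mult_left_mono integral_le integrable_continuous_interval wc powr_add_le_two_powr
          continuous_on_mult continuous_on_add continuous_on_const fc) auto
    also have "\<dots> = 18 powr p * (C * (2 powr p * (integral {0..2*pi} (\<lambda>t. norm (f (of_real r * cis t)) powr p) + 2 * pi * norm (a 0) powr p)))"
      by (subst integral_mult_right, subst Henstock_Kurzweil_Integration.integral_add)
        (auto intro: integrable_continuous_interval fc)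
    also have "\<dots> \<le> K"
      unfolding K_def using C by (intro mult_left_mono add_right_mono B r) auto
    finally show "(\<Sum>n<N. real n powr (p - 2) * (norm (a n + b n) * r ^ n) powr p) \<le> K" .
  qed (use p in auto)
  let ?m = "max 1 (2 powr (p - 2))"
  \<comment> \<open>The factor \<open>?m\<close> pays for passing from \<open>n\<close> to
    \<open>n + 1\<close> in the weight, the factor 2 for bounding both \<open>norm (a n)\<close> and
    \<open>norm (b n)\<close> by the norm of the sum.\<close>
  from summable_mult[OF S, of "2 * ?m"] show ?thesis
  proof (rule summable_comparison_test'[where N=1])
    fix n :: nat assume n: "1 \<le> n"
    have na: "norm (a n) \<le> norm (a n + b n)" and nb: "norm (b n) \<le> norm (a n + b n)"
    proof -
      have "a n + b n = of_real (norm (a n) + norm (b n))"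
        using decreasing_to_zero_Re[OF dec(1) n] decreasing_to_zero_Re[OF dec(2) n]
        by (simp add: complex_eq_iff)
      then have "norm (a n + b n) = norm (a n) + norm (b n)"
        by (metis abs_of_nonneg add_nonneg_nonneg norm_ge_zero norm_of_real)
      then show "norm (a n) \<le> norm (a n + b n)" "norm (b n) \<le> norm (a n + b n)" by simp_all
    qed
    have "real (n + 1) powr (p - 2) * (norm (a n) powr p + norm (b n) powr p)
      \<le> (?m * real n powr (p - 2)) * (norm (a n + b n) powr p + norm (a n + b n) powr p)"
      using powr_Suc_le[OF n, of "p - 2"] p by (intro mult_mono add_mono powr_mono2 na nb) auto
    then show "norm (real (n + 1) powr (p - 2) * (norm (a n) powr p + norm (b n) powr p))
      \<le> 2 * ?m * (real n powr (p - 2) * norm (a n + b n) powr p)"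
      by (simp add: mult_ac)
  qed
qed

end

subsection \<open>Power series with decreasing coefficients\<close>

lemma decreasing_powser_remainder_le:
  fixes a :: "nat \<Rightarrow> complex" and h :: "complex \<Rightarrow> complex"
  assumes sums: "(\<lambda>n. a n * z ^ n) sums h z" and dec: "decreasing_to_zero a"
    and z: "norm z \<le> 1" and n: "1 \<le> n"
  shows "norm (1 - z) * norm (h z - (\<Sum>k<n. a k * z ^ k)) \<le> 2 * norm (a n)"
proof -
  define R where "R = h z - (\<Sum>k<n. a k * z ^ k)"
  have R: "(\<lambda>k. a (k + n) * z ^ (k + n)) sums R"
    unfolding R_def by (rule sums_split_initial_segment[OF sums])
  have "(\<lambda>k. a (Suc k + n) * z ^ (Suc k + n)) sums (R - a n * z ^ n)"
    using R by (subst sums_Suc_iff) simp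
  from sums_diff[OF this sums_mult[OF R, of z]]
  have D: "(\<lambda>k. (a (Suc k + n) - a (k + n)) * z ^ (Suc k + n)) sums (R - a n * z ^ n - z * R)"
    by (simp add: algebra_simps)
  have lim: "(\<lambda>k. Re (a (k + n))) \<longlonglongrightarrow> 0"
    using dec LIMSEQ_ignore_initial_segment[of a 0 n] tendsto_Re[of "\<lambda>k. a (k + n)" 0]
    by (simp add: decreasing_to_zero_def)
  have T: "(\<lambda>k. Re (a (k + n)) - Re (a (Suc k + n))) sums norm (a n)"
    using telescope_sums'[OF lim] decreasing_to_zero_Re[OF dec n] by simp
  have le: "norm ((a (Suc k + n) - a (k + n)) * z ^ (Suc k + n)) \<le> Re (a (k + n)) - Re (a (Suc k + n))" for k
  proof -
    have "a (Suc k + n) - a (k + n) = of_real (Re (a (Suc k + n)) - Re (a (k + n)))"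
      using decreasing_to_zero_Re[OF dec, of "Suc k + n"] decreasing_to_zero_Re[OF dec, of "k + n"] n
      by (simp add: complex_eq_iff)
    then have "norm (a (Suc k + n) - a (k + n)) = \<bar>Re (a (Suc k + n)) - Re (a (k + n))\<bar>"
      by (metis norm_of_real)
    also have "\<dots> = Re (a (k + n)) - Re (a (Suc k + n))"
      using decreasing_to_zero_mono[OF dec, of "k + n" "Suc k + n"] n by simp
    finally have "norm (a (Suc k + n) - a (k + n)) = Re (a (k + n)) - Re (a (Suc k + n))" .
    moreover have "norm (z ^ (Suc k + n)) \<le> 1"
      using z by (simp only: norm_power) (simp add: power_le_one del: power_Suc)
    moreover have "norm (a (Suc k + n) - a (k + n)) * norm (z ^ (Suc k + n)) \<le> norm (a (Suc k + n) - a (k + n)) * 1"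
      by (intro mult_left_mono calculation(2)) simp
    ultimately show ?thesis by (simp only: norm_mult mult_1_right)
  qed
  have "norm (R - a n * z ^ n - z * R) \<le> norm (a n)"
    using norm_suminf_le[OF le sums_summable[OF T]] D T by (simp add: sums_iff)
  moreover have "norm (a n * z ^ n) \<le> norm (a n)"
    using z by (simp add: norm_mult norm_power mult_right_le_one_le power_le_one)
  moreover have "(1 - z) * R = (R - a n * z ^ n - z * R) + a n * z ^ n"
    by (simp add: algebra_simps)
  ultimately have "norm ((1 - z) * R) \<le> 2 * norm (a n)"
    using norm_triangle_ineq[of "R - a n * z ^ n - z * R" "a n * z ^ n"] by simp
  then show ?thesis by (simp add: norm_mult R_def)
qed

text \<open>The coefficients of \<open>(1 - z) * h z\<close> are absolutely summable.\<close>

lemma decreasing_powser_boundary_limit: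
  fixes a :: "nat \<Rightarrow> complex" and h :: "complex \<Rightarrow> complex"
  assumes sums: "\<And>z. z \<in> ball 0 1 \<Longrightarrow> (\<lambda>n. a n * z ^ n) sums h z" and dec: "decreasing_to_zero a"
  obtains k where "\<And>\<zeta>. \<lbrakk>norm \<zeta> = 1; \<zeta> \<noteq> 1\<rbrakk> \<Longrightarrow> ((\<lambda>r. h (of_real r * \<zeta>)) \<longlongrightarrow> k \<zeta>) (at_left 1)"
proof
  define d where "d n = a (Suc n) - a n" for n
  have ds: "summable (\<lambda>n. norm (d n))"
  proof -
    have lim: "(\<lambda>n. Re (a (Suc n))) \<longlonglongrightarrow> 0"
      using dec LIMSEQ_Suc[of a 0] tendsto_Re[of "\<lambda>n. a (Suc n)" 0]
      by (simp add: decreasing_to_zero_def)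
    have "norm (d (Suc n)) = Re (a (Suc n)) - Re (a (Suc (Suc n)))" for n
    proof -
      have "d (Suc n) = of_real (Re (a (Suc (Suc n))) - Re (a (Suc n)))"
        using decreasing_to_zero_Re[OF dec, of "Suc n"] decreasing_to_zero_Re[OF dec, of "Suc (Suc n)"]
        by (simp add: complex_eq_iff d_def)
      then have "norm (d (Suc n)) = \<bar>Re (a (Suc (Suc n))) - Re (a (Suc n))\<bar>"
        by (metis norm_of_real)
      then show ?thesis using decreasing_to_zero_mono[OF dec, of "Suc n" "Suc (Suc n)"] by simp
    qed
    \<comment> \<open>The telescoping begins at index 1, since \<open>d 0\<close> involves the
      unconstrained \<open>a 0\<close>; one extra term does not affect summability.\<close>
    then have "summable (\<lambda>n. norm (d (Suc n)))"
      using sums_summable[OF telescope_sums'[OF lim]] by simp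
    then show ?thesis by (subst (asm) summable_Suc_iff)
  qed
  \<comment> \<open>\<open>E z\<close> is \<open>(1 - z) * h z\<close> in the disc and continuous up
    to the boundary, so dividing by \<open>1 - z\<close> gives radial limits away from 1.\<close>
  define E where "E z = a 0 + (\<Sum>n. d n * z ^ Suc n)" for z
  have Ec: "continuous_on (cball 0 1) E"
  proof -
    have "uniform_limit (cball 0 1) (\<lambda>m z. \<Sum>n<m. d n * z ^ Suc n) (\<lambda>z. \<Sum>n. d n * z ^ Suc n) sequentially"
    proof (rule Weierstrass_m_test[OF _ ds])
      fix n and z :: complex assume "z \<in> cball 0 1"
      then show "norm (d n * z ^ Suc n) \<le> norm (d n)"
        by (simp only: norm_mult norm_power) (simp add: mult_right_le_one_le power_le_one del: power_Suc)
    qed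
    then have "continuous_on (cball 0 1) (\<lambda>z. \<Sum>n. d n * z ^ Suc n)"
      by (rule uniform_limit_theorem[rotated]) (auto intro!: always_eventually continuous_intros)
    then show ?thesis unfolding E_def by (intro continuous_intros)
  qed
  have E: "h z = E z / (1 - z)" if z: "z \<in> ball 0 1" for z
  proof -
    have "(\<lambda>n. a (Suc n) * z ^ Suc n) sums (h z - a 0)"
      using sums[OF z] by (subst sums_Suc_iff) simp
    from sums_diff[OF this sums_mult[OF sums[OF z], of z]]
    have "(\<lambda>n. d n * z ^ Suc n) sums (h z - a 0 - z * h z)"
      by (simp add: d_def algebra_simps)
    then have "E z = (1 - z) * h z"
      by (simp add: E_def sums_iff algebra_simps)
    moreover have "1 - z \<noteq> 0" using z by auto
    ultimately show ?thesis by simp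
  qed
  fix \<zeta> :: complex assume \<zeta>: "norm \<zeta> = 1" "\<zeta> \<noteq> 1"
  have "((\<lambda>r. E (of_real r * \<zeta>) / (1 - of_real r * \<zeta>)) \<longlongrightarrow> E \<zeta> / (1 - \<zeta>)) (at_left 1)"
  proof -
    have r: "((\<lambda>r. of_real r * \<zeta>) \<longlongrightarrow> of_real 1 * \<zeta>) (at_left (1::real))"
      by (intro tendsto_intros)
    have "((\<lambda>r. E (of_real r * \<zeta>)) \<longlongrightarrow> E \<zeta>) (at_left (1::real))"
    proof (rule continuous_on_tendsto_compose[OF Ec])
      show "((\<lambda>r. of_real r * \<zeta>) \<longlongrightarrow> \<zeta>) (at_left (1::real))" using r by simp
      show "\<zeta> \<in> cball 0 1" using \<zeta> by simp
      show "\<forall>\<^sub>F r in at_left (1::real). of_real r * \<zeta> \<in> cball 0 1"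
        unfolding eventually_at_left_field using \<zeta> by (intro exI[of _ 0]) (auto simp: norm_mult)
    qed
    moreover have "((\<lambda>r. 1 - of_real r * \<zeta>) \<longlongrightarrow> 1 - \<zeta>) (at_left (1::real))"
      using tendsto_diff[OF tendsto_const r] by simp
    ultimately show ?thesis using \<zeta> by (intro tendsto_divide) auto
  qed
  moreover have "\<forall>\<^sub>F r in at_left (1::real). E (of_real r * \<zeta>) / (1 - of_real r * \<zeta>) = h (of_real r * \<zeta>)"
    unfolding eventually_at_left_field using \<zeta> by (intro exI[of _ 0]) (auto simp: norm_mult E)
  ultimately show "((\<lambda>r. h (of_real r * \<zeta>)) \<longlongrightarrow> E \<zeta> / (1 - \<zeta>)) (at_left 1)"
    by (rule Lim_transform_eventually)
qed

text \<open>The squared distance is (1 - r)^2 + 4 r sin^2 (t / 2), and \<open>r >= 1/2\<close>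
  leaves at least sin^2 (t / 2). The minimum is the arc distance to the point 1. The case
  \<open>r = 1\<close> is included and later shows \<open>cis t\<close> differs from 1.\<close>

lemma norm_one_minus_circle_ge:
  assumes r: "1 / 2 \<le> r" and t: "0 \<le> t" "t \<le> 2 * pi"
  shows "min t (2 * pi - t) / 6 \<le> norm (1 - of_real r * cis t)"
proof -
  have pi: "pi / 2 \<le> 2" using pi_less_4 by simp
  have s: "min t (2 * pi - t) / 6 \<le> sin (t / 2)"
  proof (cases "t \<le> pi")
    case True
    then have "t / 2 / 3 \<le> sin (t / 2)" using t pi by (intro sin_ge_third) auto
    then show ?thesis by simp
  next
    case False
    then have "(pi - t / 2) / 3 \<le> sin (pi - t / 2)" using t pi by (intro sin_ge_third) auto
    then show ?thesis by simp
  qed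
  have "(norm (1 - of_real r * cis t))\<^sup>2 = (1 - r * cos t)\<^sup>2 + (r * sin t)\<^sup>2"
    by (simp add: cmod_power2)
  also have "\<dots> = (1 - r)\<^sup>2 + 2 * r * (1 - cos t)"
  proof -
    have "(r * sin t)\<^sup>2 = r\<^sup>2 * (1 - (cos t)\<^sup>2)"
      by (simp add: power_mult_distrib sin_squared_eq)
    then show ?thesis by (simp add: power2_eq_square algebra_simps)
  qed
  also have "1 - cos t = 2 * (sin (t / 2))\<^sup>2"
    using cos_double_sin[of "t / 2"] by simp
  finally have eq: "(norm (1 - of_real r * cis t))\<^sup>2 = (1 - r)\<^sup>2 + 4 * r * (sin (t / 2))\<^sup>2" by simp
  have "1 * (sin (t / 2))\<^sup>2 \<le> 4 * r * (sin (t / 2))\<^sup>2"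
    using r by (intro mult_right_mono) auto
  then have "(sin (t / 2))\<^sup>2 \<le> (norm (1 - of_real r * cis t))\<^sup>2"
    unfolding eq by (smt (verit) zero_le_power2)
  then have "sin (t / 2) \<le> norm (1 - of_real r * cis t)"
    by (rule power2_le_imp_le) simp
  with s show ?thesis by simp
qed

text \<open>With \<open>m\<close> the floor of \<open>pi / s\<close>, the remainder after
  \<open>a m\<close> is at most \<open>12 / s\<close> times the next coefficient. As
  \<open>pi > 3\<close> and \<open>pi / s <= 2 * m\<close>, this is at most \<open>8 * m\<close>
  times that coefficient, hence at most 8 times the sum of the \<open>m\<close> larger ones; the
  terms 1 to \<open>m\<close> themselves make it 9.\<close>

lemma decreasing_powser_le_partial_sum:
  fixes a :: "nat \<Rightarrow> complex" and h :: "complex \<Rightarrow> complex"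
  assumes sums: "(\<lambda>n. a n * z ^ n) sums h z" and dec: "decreasing_to_zero a"
    and z: "norm z \<le> 1" and s: "0 < s" "s \<le> pi" "s / 6 \<le> norm (1 - z)"
  shows "norm (h z) \<le> norm (a 0) + 9 * (\<Sum>k<nat \<lfloor>pi / s\<rfloor>. norm (a (Suc k)))"
proof -
  define m where "m = nat \<lfloor>pi / s\<rfloor>"
  have y: "1 \<le> pi / s" using s by simp
  have m: "1 \<le> nat \<lfloor>x\<rfloor>" "x \<le> 2 * real (nat \<lfloor>x\<rfloor>)" if "1 \<le> x" for x :: real
  proof -
    have "1 \<le> \<lfloor>x\<rfloor>" using that by simp
    then show "1 \<le> nat \<lfloor>x\<rfloor>" by linarith
    have "x < real_of_int \<lfloor>x\<rfloor> + 1" by linarith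
    have "1 \<le> real_of_int \<lfloor>x\<rfloor>" "real (nat \<lfloor>x\<rfloor>) = real_of_int \<lfloor>x\<rfloor>"
      using \<open>1 \<le> \<lfloor>x\<rfloor>\<close> by (simp_all only: of_int_1_le_iff of_nat_nat)
    then show "x \<le> 2 * real (nat \<lfloor>x\<rfloor>)"
      using \<open>x < real_of_int \<lfloor>x\<rfloor> + 1\<close> by linarith
  qed
  have m1: "1 \<le> m" and m2: "pi / s \<le> 2 * real m"
    unfolding m_def by (rule m[OF y])+
  define n where "n = Suc m"
  define S where "S = (\<Sum>k<m. norm (a (Suc k)))"
  have a_le: "norm (a n) \<le> norm (a (Suc k))" if "k < m" for k
    using decreasing_to_zero_mono[OF dec, of "Suc k" n] that
      decreasing_to_zero_Re[OF dec, of n] decreasing_to_zero_Re[OF dec, of "Suc k"] by (simp add: n_def)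
  have "real m * norm (a n) = (\<Sum>k<m. norm (a n))" by simp
  also have "\<dots> \<le> S" unfolding S_def by (intro sum_mono a_le) auto
  finally have ma: "real m * norm (a n) \<le> S" .
  have "s / 6 * norm (h z - (\<Sum>k<n. a k * z ^ k)) \<le> norm (1 - z) * norm (h z - (\<Sum>k<n. a k * z ^ k))"
    using s by (intro mult_right_mono) auto
  also have "\<dots> \<le> 2 * norm (a n)"
    by (rule decreasing_powser_remainder_le[where h=h, OF sums dec z]) (simp add: n_def)
  finally have "norm (h z - (\<Sum>k<n. a k * z ^ k)) \<le> 12 / s * norm (a n)"
    using s by (simp add: field_simps)
  also have "12 / s \<le> 4 * (pi / s)"
    using s pi_gt3 by (simp add: field_simps)
  then have "12 / s * norm (a n) \<le> 4 * (pi / s) * norm (a n)"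
    by (intro mult_right_mono) auto
  also have "\<dots> \<le> 4 * (2 * real m) * norm (a n)"
    using m2 by (intro mult_right_mono) auto
  also have "\<dots> \<le> 8 * S" using ma by simp
  finally have rem: "norm (h z - (\<Sum>k<n. a k * z ^ k)) \<le> 8 * S" by simp
  have "norm (\<Sum>k<n. a k * z ^ k) \<le> (\<Sum>k<n. norm (a k))"
    using z by (intro order_trans[OF norm_sum] sum_mono) (simp add: norm_mult norm_power mult_right_le_one_le power_le_one)
  also have "\<dots> = norm (a 0) + S"
    unfolding n_def S_def by (rule sum.lessThan_Suc_shift)
  finally have "norm (h z) \<le> norm (a 0) + S + 8 * S"
    using rem norm_triangle_ineq[of "h z - (\<Sum>k<n. a k * z ^ k)" "\<Sum>k<n. a k * z ^ k"] by simp
  then show ?thesis by (simp add: S_def m_def)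
qed

text \<open>Discrete counterpart of the weighted integral estimate, with the weight
  \<open>real (Suc k) powr (-((p - 1) / p))\<close>. The real bound \<open>y\<close> replaces
  \<open>m\<close> so that \<open>pi / s\<close> can be inserted without its floor.\<close>

lemma powr_sum_le_weighted:
  fixes x :: "nat \<Rightarrow> real" and p y :: real
  assumes p: "1 < p" and x: "\<And>k. 0 \<le> x k" and y: "0 < y" "real m \<le> y"
  shows "(\<Sum>k<m. x k) powr p \<le> 2 powr p * (p * y powr (1 / p)) powr (p - 1)
    * (\<Sum>k<m. x k powr p * real (Suc k) powr ((p - 1) * (p - 1) / p))"
proof (rule powr_le_of_parametric_bound)
  fix K :: real assume K: "0 < K"
  define \<alpha> where "\<alpha> = (p - 1) / p"
  have \<alpha>: "0 < \<alpha>" "\<alpha> < 1" "1 - \<alpha> = 1 / p" using p by (auto simp: \<alpha>_def field_simps)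
  have "(\<Sum>k<m. x k) \<le> (\<Sum>k<m. K * real (Suc k) powr (-\<alpha>)
      + K powr (1 - p) * (x k powr p * real (Suc k) powr ((p - 1) * (p - 1) / p)))"
  proof (rule sum_mono)
    fix k
    have "x k \<le> K * real (Suc k) powr (-\<alpha>) + x k powr p * (K * real (Suc k) powr (-\<alpha>)) powr (1 - p)"
      using K p x by (intro le_add_powr_mult_powr) auto
    also have "(K * real (Suc k) powr (-\<alpha>)) powr (1 - p) = K powr (1 - p) * real (Suc k) powr ((p - 1) * (p - 1) / p)"
    proof -
      have "(-\<alpha>) * (1 - p) = \<alpha> * (p - 1)" by (simp add: algebra_simps)
      then have "(-\<alpha>) * (1 - p) = (p - 1) * (p - 1) / p" by (simp add: \<alpha>_def)
      then show ?thesis using K by (simp add: powr_mult powr_powr)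
    qed
    finally show "x k \<le> K * real (Suc k) powr (-\<alpha>)
      + K powr (1 - p) * (x k powr p * real (Suc k) powr ((p - 1) * (p - 1) / p))"
      by (simp only: mult_ac)
  qed
  also have "\<dots> = K * (\<Sum>k<m. real (Suc k) powr (-\<alpha>))
      + K powr (1 - p) * (\<Sum>k<m. x k powr p * real (Suc k) powr ((p - 1) * (p - 1) / p))"
    by (simp only: sum.distrib sum_distrib_left)
  also have "(\<Sum>k<m. real (Suc k) powr (-\<alpha>)) \<le> p * y powr (1 / p)"
  proof -
    have "(\<Sum>k<m. real (Suc k) powr (-\<alpha>)) \<le> real m powr (1 - \<alpha>) / (1 - \<alpha>)"
      by (rule sum_powr_neg_le[OF \<alpha>(1,2)])
    also have "\<dots> \<le> y powr (1 - \<alpha>) / (1 - \<alpha>)"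
      using y \<alpha> p by (intro divide_right_mono powr_mono2) auto
    finally show ?thesis using p unfolding \<alpha>(3) by (simp add: mult.commute)
  qed
  finally show "(\<Sum>k<m. x k) \<le> K * (p * y powr (1 / p))
      + K powr (1 - p) * (\<Sum>k<m. x k powr p * real (Suc k) powr ((p - 1) * (p - 1) / p))"
    using K by simp
qed (use p x y in \<open>auto intro!: sum_nonneg\<close>)

text \<open>A dual form of Hardy's inequality. For fixed \<open>s\<close> the weighted estimate is a
  sum over \<open>k < pi / s\<close> rounded down, that is, over \<open>s <= pi / (k + 1)\<close>;
  read as a series of functions of \<open>s\<close> it has integrable terms, whose integrals are a
  constant times the given summable terms, because (p - 1)^2 / p - 1 / p = p - 2.\<close>

lemma partial_sum_powr_integrable_majorant:
  fixes x :: "nat \<Rightarrow> real" and p :: real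
  assumes p: "1 < p" and x: "\<And>k. 0 \<le> x k"
    and summable: "summable (\<lambda>k. real (Suc k) powr (p - 2) * x k powr p)"
  obtains G where "G integrable_on {0..2*pi}" "\<And>t. 0 \<le> G t"
    "\<And>s. \<lbrakk>0 < s; s \<le> pi\<rbrakk> \<Longrightarrow> (\<Sum>k<nat \<lfloor>pi / s\<rfloor>. x k) powr p \<le> G s"
proof
  define \<alpha> where "\<alpha> = (p - 1) / p"
  have \<alpha>: "0 < \<alpha>" "\<alpha> < 1" "1 - \<alpha> = 1 / p" using p by (auto simp: \<alpha>_def field_simps)
  define A where "A k = x k powr p * real (Suc k) powr ((p - 1) * (p - 1) / p)" for k
  have A0: "0 \<le> A k" for k by (simp add: A_def)
  define D where "D = 2 powr p * (p powr (p - 1) * pi powr \<alpha>)"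
  have D0: "0 \<le> D" using p by (simp add: D_def)
  define u where "u k t = (if t \<in> {0..pi / real (Suc k)} then D * A k * t powr (-\<alpha>) else 0)" for k t
  have u0: "0 \<le> u k t" for k t using A0 D0 by (simp add: u_def)
  define G where "G t = (\<Sum>k. u k t)" for t
  have iff: "s \<le> pi / real (Suc k) \<longleftrightarrow> k < nat \<lfloor>pi / s\<rfloor>" if "0 < s" for k s
  proof -
    have "s \<le> pi / real (Suc k) \<longleftrightarrow> real (Suc k) \<le> pi / s"
      using that by (simp add: field_simps)
    also have "\<dots> \<longleftrightarrow> int (Suc k) \<le> \<lfloor>pi / s\<rfloor>" by (simp add: le_floor_iff)
    also have "\<dots> \<longleftrightarrow> k < nat \<lfloor>pi / s\<rfloor>" by linarith
    finally show ?thesis .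
  qed
  \<comment> \<open>For \<open>t > 0\<close> only finitely many terms are nonzero. At 0 they all
    vanish, as \<open>0 powr (-\<alpha>) = 0\<close>, so the majorant is finite everywhere.\<close>
  have usum: "summable (\<lambda>k. u k t)" for t
  proof (cases "0 < t")
    case True
    then show ?thesis
      by (intro summable_finite[of "{..<nat \<lfloor>pi / t\<rfloor>}"]) (auto simp: u_def iff simp del: of_nat_Suc)
  next
    case False
    then have "u k t = 0" for k by (auto simp: u_def)
    then show ?thesis by simp
  qed
  show "0 \<le> G t" for t
    unfolding G_def by (intro suminf_nonneg usum u0)
  have uint: "(u k has_integral (D * p * pi powr (1 / p)) * (real (Suc k) powr (p - 2) * x k powr p)) {0..2*pi}" for k
  proof -
    have "((\<lambda>t. D * A k * t powr (-\<alpha>)) has_integral D * A k * ((pi / real (Suc k)) powr (-\<alpha> + 1) / (-\<alpha> + 1))) {0..pi / real (Suc k)}"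
      using \<alpha> by (intro has_integral_mult_right has_integral_powr_from_0) auto
    also have "D * A k * ((pi / real (Suc k)) powr (-\<alpha> + 1) / (-\<alpha> + 1)) = (D * p * pi powr (1 / p)) * (real (Suc k) powr (p - 2) * x k powr p)"
    proof -
      have e1: "-\<alpha> + 1 = 1 / p" using \<alpha> by simp
      have "(p - 1) * (p - 1) / p - 1 / p = p - 2" using p by (simp add: field_simps)
      then have e2: "real (Suc k) powr ((p - 1) * (p - 1) / p) / real (Suc k) powr (1 / p) = real (Suc k) powr (p - 2)"
        by (simp only: powr_diff[symmetric])
      have "D * A k * ((pi / real (Suc k)) powr (-\<alpha> + 1) / (-\<alpha> + 1))
         = (D * p * pi powr (1 / p)) * (x k powr p * (real (Suc k) powr ((p - 1) * (p - 1) / p) / real (Suc k) powr (1 / p)))"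
        unfolding e1 A_def using p by (subst powr_divide) (auto simp: mult_ac)
      then show ?thesis unfolding e2 by (simp only: mult_ac)
    qed
    finally have *: "((\<lambda>t. D * A k * t powr (-\<alpha>)) has_integral (D * p * pi powr (1 / p)) * (real (Suc k) powr (p - 2) * x k powr p)) {0..pi / real (Suc k)}" .
    have "pi / real (Suc k) \<le> pi / 1" by (intro divide_left_mono) auto
    also have "\<dots> \<le> 2 * pi" by simp
    finally have sub: "{0..pi / real (Suc k)} \<subseteq> {0..2*pi}" by auto
    show ?thesis unfolding u_def by (subst has_integral_restrict[OF sub]) (rule *)
  qed
  define I where "I k = (D * p * pi powr (1 / p)) * (real (Suc k) powr (p - 2) * x k powr p)" for k
  have I0: "0 \<le> I k" for k using p D0 by (simp add: I_def)
  have Isum: "summable I" unfolding I_def by (intro summable_mult summable)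
  have sums_int: "((\<lambda>t. \<Sum>k<N. u k t) has_integral (\<Sum>k<N. I k)) {0..2*pi}" for N
    unfolding I_def by (intro has_integral_sum uint) auto
  have "G integrable_on {0..2*pi} \<and> (\<lambda>N. integral {0..2*pi} (\<lambda>t. \<Sum>k<N. u k t)) \<longlonglongrightarrow> integral {0..2*pi} G"
  proof (rule monotone_convergence_increasing)
    show "(\<lambda>t. \<Sum>k<N. u k t) integrable_on {0..2*pi}" for N
      using sums_int by (auto simp: integrable_on_def)
    show "(\<Sum>k<N. u k t) \<le> (\<Sum>k<Suc N. u k t)" for N t using u0 by simp
    show "(\<lambda>N. \<Sum>k<N. u k t) \<longlonglongrightarrow> G t" for t
      unfolding G_def by (rule summable_LIMSEQ[OF usum])
    have "norm (\<Sum>k<N. I k) \<le> suminf I" for N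
      using sum_le_suminf[OF Isum] I0 by (simp add: sum_nonneg)
    then show "bounded (range (\<lambda>N. integral {0..2*pi} (\<lambda>t. \<Sum>k<N. u k t)))"
      unfolding integral_unique[OF sums_int] bounded_iff by blast
  qed
  then show "G integrable_on {0..2*pi}" ..
  fix s assume s: "0 < s" "s \<le> pi"
  define m where "m = nat \<lfloor>pi / s\<rfloor>"
  have "(\<Sum>k<m. x k) powr p \<le> 2 powr p * (p * (pi / s) powr (1 / p)) powr (p - 1) * (\<Sum>k<m. A k)"
    unfolding A_def using p x s by (intro powr_sum_le_weighted) (auto simp: m_def)
  also have "2 powr p * (p * (pi / s) powr (1 / p)) powr (p - 1) = D * s powr (-\<alpha>)"
  proof -
    have "((pi / s) powr (1 / p)) powr (p - 1) = (pi / s) powr \<alpha>"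
      by (simp add: powr_powr \<alpha>_def)
    also have "\<dots> = pi powr \<alpha> * s powr (-\<alpha>)"
      using s by (simp add: powr_divide powr_minus field_simps)
    finally show ?thesis using p by (simp add: D_def powr_mult)
  qed
  also have "D * s powr (-\<alpha>) * (\<Sum>k<m. A k) = (\<Sum>k<m. u k s)"
    unfolding sum_distrib_left using s by (intro sum.cong refl) (auto simp: u_def iff m_def mult_ac simp del: of_nat_Suc)
  also have "\<dots> \<le> G s"
    unfolding G_def by (intro sum_le_suminf usum u0) auto
  finally show "(\<Sum>k<nat \<lfloor>pi / s\<rfloor>. x k) powr p \<le> G s" by (simp add: m_def)
qed

lemma decreasing_powser_integrable_majorant:
  fixes a :: "nat \<Rightarrow> complex" and h :: "complex \<Rightarrow> complex"
  assumes sums: "\<And>z. z \<in> ball 0 1 \<Longrightarrow> (\<lambda>n. a n * z ^ n) sums h z" and dec: "decreasing_to_zero a"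
    and p: "1 < p" and summable: "summable (\<lambda>n. real (n + 1) powr (p - 2) * norm (a n) powr p)"
  obtains D where "D integrable_on {0..2*pi}"
    "\<And>r t. \<lbrakk>1 / 2 \<le> r; r < 1; 0 < t; t < 2 * pi\<rbrakk> \<Longrightarrow> norm (h (of_real r * cis t)) powr p \<le> D t"
proof -
  \<comment> \<open>The coefficient index moves by one while the weight stays; monotonicity of the
    coefficients from index 1 on allows this.\<close>
  have "summable (\<lambda>k. real (Suc k) powr (p - 2) * norm (a (Suc k)) powr p)"
  proof (rule summable_comparison_test'[OF summable, where N=1])
    fix n :: nat assume n: "1 \<le> n"
    have "norm (a (Suc n)) \<le> norm (a n)"
      using decreasing_to_zero_mono[OF dec n, of "Suc n"] decreasing_to_zero_Re[OF dec n]
        decreasing_to_zero_Re[OF dec, of "Suc n"] by simp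
    then show "norm (real (Suc n) powr (p - 2) * norm (a (Suc n)) powr p) \<le> real (n + 1) powr (p - 2) * norm (a n) powr p"
      using p by (auto intro!: mult_mono powr_mono2)
  qed
  then obtain G where G: "G integrable_on {0..2*pi}" and G0: "\<And>t. 0 \<le> G t"
    and Gs: "\<And>s. \<lbrakk>0 < s; s \<le> pi\<rbrakk> \<Longrightarrow> (\<Sum>k<nat \<lfloor>pi / s\<rfloor>. norm (a (Suc k))) powr p \<le> G s"
    by (rule partial_sum_powr_integrable_majorant[OF p norm_ge_zero]) (rule that)
  \<comment> \<open>The arc distance to 1 is \<open>t\<close> or \<open>2 * pi - t\<close>. Adding
    both values of the nonnegative \<open>G\<close> dominates \<open>G\<close> at the smaller of
    them without a case distinction in the majorant.\<close>
  define D where "D t = 2 powr p * (norm (a 0) powr p + 9 powr p * (G t + G (2 * pi - t)))" for t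
  have G': "(\<lambda>t. G (2 * pi - t)) integrable_on {0..2*pi}"
  proof -
    have "(\<lambda>t. G ((-1) *\<^sub>R t + 2 * pi)) integrable_on ((\<lambda>t. (1 / (-1)) *\<^sub>R t + - ((1 / (-1)) *\<^sub>R (2 * pi))) ` cbox 0 (2*pi))"
      by (rule integrable_affinity) (use G in auto)
    moreover have "(\<lambda>t::real. (1 / (-1)) *\<^sub>R t + - ((1 / (-1)) *\<^sub>R (2 * pi))) ` cbox 0 (2*pi) = {0..2*pi}"
      by (auto simp: image_iff intro!: bexI[of _ "2 * pi - _"])
    ultimately show ?thesis by simp
  qed
  show ?thesis
  proof
    show "D integrable_on {0..2*pi}"
      unfolding D_def by (intro integrable_on_mult_right integrable_add integrable_const_ivl G G')
    fix r t :: real assume rt: "1 / 2 \<le> r" "r < 1" "0 < t" "t < 2 * pi"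
    define s where "s = min t (2 * pi - t)"
    have s: "0 < s" "s \<le> pi" using rt by (auto simp: s_def)
    let ?z = "of_real r * cis t" and ?S = "\<Sum>k<nat \<lfloor>pi / s\<rfloor>. norm (a (Suc k))"
    have z: "norm ?z < 1" using rt by (simp add: norm_mult)
    have "norm (h ?z) \<le> norm (a 0) + 9 * ?S"
    proof (rule decreasing_powser_le_partial_sum[where h=h and z="?z", OF _ dec _ s])
      show "s / 6 \<le> norm (1 - ?z)"
        unfolding s_def using rt by (intro norm_one_minus_circle_ge) auto
    qed (use z sums in auto)
    then have "norm (h ?z) powr p \<le> (norm (a 0) + 9 * ?S) powr p"
      using p by (intro powr_mono2) auto
    also have "\<dots> \<le> 2 powr p * (norm (a 0) powr p + (9 * ?S) powr p)"
      using p by (intro powr_add_le_two_powr) (auto intro: sum_nonneg)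
    also have "(9 * ?S) powr p = 9 powr p * ?S powr p"
      by (subst powr_mult) (auto intro: sum_nonneg)
    also have "?S powr p \<le> G t + G (2 * pi - t)"
      using Gs[OF s] G0[of t] G0[of "2 * pi - t"] by (simp add: s_def min_def split: if_splits)
    finally show "norm (h ?z) powr p \<le> D t"
      by (simp add: D_def)
  qed
qed

section \<open>From summable coefficients to convergence of the integral means\<close>

context harmonic_power_series
begin

lemma harmonic_hardy_of_summable_decreasing:
  assumes dec: "decreasing_to_zero a" "decreasing_to_zero b" and p: "1 < p"
    and harm: "complex_harmonic_on f (ball 0 1)"
    and summable: "summable (\<lambda>n. real (n + 1) powr (p - 2) * (norm (a n) powr p + norm (b n) powr p))"
  shows "f \<in> harmonic_hardy p"
proof -
  have sa: "summable (\<lambda>n. real (n + 1) powr (p - 2) * norm (a n) powr p)"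
    and sb: "summable (\<lambda>n. real (n + 1) powr (p - 2) * norm (b n) powr p)"
    by (rule summable_comparison_test'[OF summable, where N=0]; simp add: distrib_left)+
  obtain D1 where D1: "D1 integrable_on {0..2*pi}"
    "\<And>r t. \<lbrakk>1 / 2 \<le> r; r < 1; 0 < t; t < 2 * pi\<rbrakk> \<Longrightarrow> norm (h (of_real r * cis t)) powr p \<le> D1 t"
    by (rule decreasing_powser_integrable_majorant[OF h_sums dec(1) p sa]) (assumption, rule that)
  obtain D2 where D2: "D2 integrable_on {0..2*pi}"
    "\<And>r t. \<lbrakk>1 / 2 \<le> r; r < 1; 0 < t; t < 2 * pi\<rbrakk> \<Longrightarrow> norm (g (of_real r * cis t)) powr p \<le> D2 t"
    by (rule decreasing_powser_integrable_majorant[OF g_sums dec(2) p sb]) (assumption, rule that)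
  obtain k1 where k1: "\<And>\<zeta>. \<lbrakk>norm \<zeta> = 1; \<zeta> \<noteq> 1\<rbrakk> \<Longrightarrow> ((\<lambda>r. h (of_real r * \<zeta>)) \<longlongrightarrow> k1 \<zeta>) (at_left 1)"
    by (rule decreasing_powser_boundary_limit[OF h_sums dec(1)]) (assumption, rule that)
  obtain k2 where k2: "\<And>\<zeta>. \<lbrakk>norm \<zeta> = 1; \<zeta> \<noteq> 1\<rbrakk> \<Longrightarrow> ((\<lambda>r. g (of_real r * \<zeta>)) \<longlongrightarrow> k2 \<zeta>) (at_left 1)"
    by (rule decreasing_powser_boundary_limit[OF g_sums dec(2)]) (assumption, rule that)
  define F where "F r t = norm (h (of_real r * cis t) + cnj (g (of_real r * cis t))) powr p" for r t
  define F1 where "F1 t = norm (k1 (cis t) + cnj (k2 (cis t))) powr p" for t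
  \<comment> \<open>The open interval excludes the endpoints, where \<open>cis t = 1\<close> and a
    radial limit may fail to exist.\<close>
  have lim: "((\<lambda>r. integral {0<..<2*pi} (F r)) \<longlongrightarrow> integral {0<..<2*pi} F1) (at_left 1)"
  \<comment> \<open>Dominated convergence is available for sequences of radii; they start beyond
    \<open>1/2\<close>, where the majorants are valid.\<close>
  proof (rule tendsto_at_left_sequentially[of "1/2"])
    fix S :: "nat \<Rightarrow> real"
    assume S1: "\<And>n. S n < 1" and S2: "\<And>n. 1 / 2 < S n" and S: "S \<longlonglongrightarrow> 1"
    have SL: "filterlim S (at_left 1) sequentially"
      using S S1 by (auto simp: filterlim_at less_le intro!: always_eventually)
    show "(\<lambda>n. integral {0<..<2*pi} (F (S n))) \<longlonglongrightarrow> integral {0<..<2*pi} F1"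
    proof (rule dominated_convergence(2))
      show "F (S n) integrable_on {0<..<2*pi}" for n
      proof -
        have "0 \<le> S n" using S2[of n] by simp
        note ch = continuous_on_circle[OF cont_h this S1] and cg = continuous_on_circle[OF cont_g this S1]
        have "F (S n) integrable_on {0..2*pi}"
          unfolding F_def using p
          by (intro integrable_continuous_interval continuous_on_powr' continuous_intros ch cg) auto
        then show ?thesis by (simp add: integrable_on_open_interval_real)
      qed
      show "(\<lambda>t. 2 powr p * (D1 t + D2 t)) integrable_on {0<..<2*pi}"
        unfolding integrable_on_open_interval_real
        by (intro integrable_on_mult_right integrable_add D1 D2)
      fix t :: real assume t: "t \<in> {0<..<2*pi}"
      show "norm (F (S n) t) \<le> 2 powr p * (D1 t + D2 t)" for n
      proof -
        have Sn: "1 / 2 \<le> S n" using S2[of n] by simp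
        have "F (S n) t \<le> (norm (h (of_real (S n) * cis t)) + norm (g (of_real (S n) * cis t))) powr p"
          unfolding F_def using p norm_triangle_ineq[of "h (of_real (S n) * cis t)" "cnj (g (of_real (S n) * cis t))"]
          by (intro powr_mono2) auto
        also have "\<dots> \<le> 2 powr p * (norm (h (of_real (S n) * cis t)) powr p + norm (g (of_real (S n) * cis t)) powr p)"
          using p by (intro powr_add_le_two_powr) auto
        also have "\<dots> \<le> 2 powr p * (D1 t + D2 t)"
          using D1(2)[OF Sn S1] D2(2)[OF Sn S1] t by (intro mult_left_mono add_mono) auto
        finally show ?thesis by (simp add: F_def)
      qed
      have "0 < min t (2 * pi - t) / 6" using t by simp
      also have "\<dots> \<le> norm (1 - of_real 1 * cis t)"
        using t by (intro norm_one_minus_circle_ge) auto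
      finally have ne: "cis t \<noteq> 1" by auto
      have "((\<lambda>r. F r t) \<longlongrightarrow> F1 t) (at_left 1)"
        unfolding F_def F1_def using p
        by (intro tendsto_powr' tendsto_norm tendsto_add tendsto_cnj k1 k2 ne tendsto_const) auto
      then show "(\<lambda>n. F (S n) t) \<longlonglongrightarrow> F1 t"
        by (rule filterlim_compose[OF _ SL])
    qed
  qed simp
  have ev: "\<forall>\<^sub>F r in at_left (1::real). (1 / (2 * pi) * integral {0<..<2*pi} (F r)) powr (1 / p) = integral_mean p r f"
    unfolding eventually_at_left_field
  proof (intro exI[of _ 0] conjI allI impI)
    fix r :: real assume "0 < r" "r < 1"
    then show "(1 / (2 * pi) * integral {0<..<2*pi} (F r)) powr (1 / p) = integral_mean p r f"
      unfolding integral_mean_def F_def integral_open_interval_real by (simp add: f_circle)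
  qed simp
  have nonneg: "0 \<le> integral {0<..<2*pi} (F r)" if "0 < r" "r < 1" for r
    unfolding integral_open_interval_real[symmetric]
  proof (rule integral_nonneg)
    show "F r integrable_on {0..2*pi}"
      unfolding F_def using p that
      by (intro integrable_continuous_interval continuous_on_powr' continuous_intros
          continuous_on_circle cont_h cont_g) auto
  qed (simp add: F_def)
  have "((\<lambda>r. (1 / (2 * pi) * integral {0<..<2*pi} (F r)) powr (1 / p)) \<longlongrightarrow>
      (1 / (2 * pi) * integral {0<..<2*pi} F1) powr (1 / p)) (at_left 1)"
  proof (intro tendsto_powr' tendsto_mult tendsto_const lim)
    \<comment> \<open>The limit integral may be 0, where the power \<open>1 / p\<close> is
      continuous only along nonnegative values.\<close>
    show "1 / (2 * pi) * integral {0<..<2*pi} F1 \<noteq> 0 \<or> 0 < 1 / p \<and>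
        (\<forall>\<^sub>F r in at_left 1. 0 \<le> 1 / (2 * pi) * integral {0<..<2*pi} (F r))"
      using p nonneg by (auto simp: eventually_at_left_field intro!: exI[of _ 0])
  qed
  then have "((\<lambda>r. integral_mean p r f) \<longlongrightarrow> (1 / (2 * pi) * integral {0<..<2*pi} F1) powr (1 / p)) (at_left 1)"
    using ev by (rule Lim_transform_eventually)
  then show ?thesis using harm by (auto simp: harmonic_hardy_def)
qed

end

theorem theorem3:
  fixes f h g :: "complex \<Rightarrow> complex" and a b :: "nat \<Rightarrow> complex"
  assumes "complex_harmonic_on f (ball 0 1)"
    and "h holomorphic_on ball 0 1" and "g holomorphic_on ball 0 1" and "g 0 = 0"
    and "\<And>z. z \<in> ball 0 1 \<Longrightarrow> f z = h z + cnj (g z)"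
    and "\<And>z. z \<in> ball 0 1 \<Longrightarrow> (\<lambda>n. a n * z ^ n) sums h z"
    and "\<And>z. z \<in> ball 0 1 \<Longrightarrow> (\<lambda>n. b n * z ^ n) sums g z"
  shows
    "(\<forall>p. 1 < p \<and> p \<le> 2 \<and> f \<in> harmonic_hardy p \<longrightarrow>
        summable (\<lambda>n. real (n + 1) powr (p - 2) * (norm (a n) powr p + norm (b n) powr p))) \<and>
     (decreasing_to_zero a \<and> decreasing_to_zero b \<longrightarrow>
        (\<forall>p>1. f \<in> harmonic_hardy p \<longleftrightarrow>
          summable (\<lambda>n. real (n + 1) powr (p - 2) * (norm (a n) powr p + norm (b n) powr p)))) \<and>
     (f \<in> harmonic_hardy 1 \<longrightarrow>
        (\<forall>p. 0 < p \<and> p < 1 \<longrightarrow>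
          summable (\<lambda>n. real (n + 1) powr (p - 2) * (norm (a n) powr p + norm (b n) powr p)))) \<and>
     ((\<forall>z\<in>ball 0 1. Im (h z) \<noteq> 0) \<and> decreasing_to_zero a \<and> decreasing_to_zero b \<and>
        f \<in> harmonic_hardy 1 \<longrightarrow>
          summable (\<lambda>n. norm (a n + b n) / real (n + 1)))"
proof -
  interpret harmonic_power_series f h g a b
    by unfold_locales (use assms in auto)
  show ?thesis
    by (intro conjI allI impI iffI; (elim conjE)?)
      (simp_all only: summable_coefficients_hp summable_coefficients_h1 summable_coefficients_Im_nonzero
        summable_coefficients_decreasing harmonic_hardy_of_summable_decreasing assms(1) Ball_def simp_thms)
qed

end
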